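(* Let $L$ be the geometric lattice of an oriented matroid $\mathcal{O}$, and let $L_{\widehat0}$ be the lattice obtained from $L$ by adding a new minimal element $\widehat0$ below all elements of $L$. Then $$\vartheta(F(L_{\widehat0}))=2\,F(Z),$$ where $Z$ is the dual face lattice of $\mathcal{O}$. In particular, when $\mathcal{O}$ corresponds to an arrangement of hyperplanes, then $Z$ is the face lattice of the associated zonotope.
   Context: The geometric lattice of $\mathcal{O}$ is the lattice of flats of its underlying matroid (for a central hyperplane arrangement, the lattice of intersections ordered by reverse inclusion). The face lattice of $\mathcal{O}$ is its poset of covectors (with $0$ as minimum) with a maximal element $\widehat1$ adjoined; the dual face lattice is the opposite poset. For a central hyperplane arrangement, the associated zonotope is the Minkowski sum of line segments, one in the direction of a normal vector of each hyperplane; face lattices of polytopes include the empty face and the whole polytope. A graded poset is a finite poset with unique minimal and maximal elements all of whose maximal chains have the same length. Put $[n]=\{1,\dots,n\}$, $[0]=\emptyset$. For a composition $\beta=(\beta_1,\dots,\beta_k)$, $M_\beta=\sum_{i_1<\cdots<i_k}x_{i_1}^{\beta_1}\cdots x_{i_k}^{\beta_k}$. For $S=\{i_1<\dots<i_k\}\subset[n]$ let $M_S=M_S^{(n+1)}=M_{(i_1,i_2-i_1,\dots,i_k-i_{k-1},n+1-i_k)}$ (with $M^{(n+1)}_\emptyset=M_{(n+1)}$). For a graded poset $P$ of rank $n+1$, $F(P)=\sum_{S\subset[n]}f_S(P)M_S^{(n+1)}$, where $f_S(P)$ is the number of chains in $P$ whose elements have precisely the ranks in $S$. For $S\subset[n]$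 let $F_S=F_S^{(n+1)}=\sum_{S\subset T\subset[n]}M_T^{(n+1)}$; these form a basis of the space of homogeneous quasisymmetric functions of degree $n+1$ over $\mathbb{Q}$. For $S\subset[n]$, $\Lambda(S)=\{i\in S:i\ne1,\ i-1\notin S\}$. For $S\subset[n]$ with $1\notin S$ and no two consecutive elements, $\Theta_S=\sum_{T\subset[n]:\,S\subset T\cup(T+1)}2^{|T|+1}M_T^{(n+1)}$, where $T+1=\{i+1:i\in T\}$. $\vartheta$ is the linear map with $\vartheta(F_S^{(n+1)})=\Theta_{\Lambda(S)}$ for $S\subset[n]$, $n\ge0$. *)

theory Defs
  imports
    "HOL-Analysis.Analysis"
    "HOL-Library.Function_Algebras"
    "HOL-Library.Set_Algebras"
    "HOL-Library.Poly_Mapping"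
begin

section \<open>Quasisymmetric functions\<close>

text \<open>
  A formal power series over the rationals in the variables \<open>x\<^sub>0, x\<^sub>1, x\<^sub>2, \<dots>\<close> is the function
  giving the coefficient of every monomial; a monomial is its finitely supported exponent function.
  (Starting the numbering of the variables at 0 instead of 1 is immaterial.)
\<close>

type_synonym pseries = "(nat \<Rightarrow>\<^sub>0 nat) \<Rightarrow> rat"

definition scale :: "rat \<Rightarrow> pseries \<Rightarrow> pseries"  (infixr \<open>*\<^sub>q\<close> 75)
  where "c *\<^sub>q f = (\<lambda>m. c * f m)"

global_interpretation pser: vector_space scale
  by standard (auto simp: scale_def fun_eq_iff algebra_simps)

global_interpretation pser_pair: vector_space_pair scale scale
  by (rule vector_space_pair.intro; rule pser.vector_space_axioms)

text \<open>
  \<open>M\<^sub>\<beta>\<close>: the coefficient of a monomial \<open>m\<close> is the number of index sequences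
  \<open>i\<^sub>1 < \<dots> < i\<^sub>k\<close> whose term \<open>x\<^bsub>i\<^sub>1\<^esub>\<^bsup>\<beta>\<^sub>1\<^esup> \<dots> x\<^bsub>i\<^sub>k\<^esub>\<^bsup>\<beta>\<^sub>k\<^esup>\<close> equals \<open>m\<close>.
\<close>

definition monomial_qsym :: "nat list \<Rightarrow> pseries" where
  "monomial_qsym \<beta> = (\<lambda>m. of_nat (card {is. sorted_wrt (<) is \<and> length is = length \<beta> \<and>
     (\<Sum>j<length \<beta>. Poly_Mapping.single (is ! j) (\<beta> ! j)) = m}))"

fun successive_diffs :: "nat \<Rightarrow> nat list \<Rightarrow> nat list" where
  "successive_diffs a [] = []"
| "successive_diffs a (x # xs) = (x - a) # successive_diffs x xs"

text \<open>
  In \<open>M_set n S\<close>, \<open>F_set n S\<close> and \<open>Theta_set n S\<close> the degree is \<open>n + 1\<close> and \<open>S \<subseteq> {1..n}\<close>.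
\<close>

definition composition_of_set :: "nat \<Rightarrow> nat set \<Rightarrow> nat list" where
  "composition_of_set n S = successive_diffs 0 (sorted_list_of_set S @ [n + 1])"

definition M_set :: "nat \<Rightarrow> nat set \<Rightarrow> pseries" where
  "M_set n S = monomial_qsym (composition_of_set n S)"

definition F_set :: "nat \<Rightarrow> nat set \<Rightarrow> pseries" where
  "F_set n S = (\<Sum>T | S \<subseteq> T \<and> T \<subseteq> {1..n}. M_set n T)"

definition Lambda_set :: "nat set \<Rightarrow> nat set" where
  "Lambda_set S = {i \<in> S. i \<noteq> 1 \<and> i - 1 \<notin> S}"

definition Theta_set :: "nat \<Rightarrow> nat set \<Rightarrow> pseries" where
  "Theta_set n S =
     (\<Sum>T | T \<subseteq> {1..n} \<and> S \<subseteq> T \<union> (\<lambda>i. i + 1) ` T. 2 ^ (card T + 1) *\<^sub>q M_set n T)"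

definition F_index :: "(nat \<times> nat set) set" where
  "F_index = {(n, S). S \<subseteq> {1..n}}"

definition F_basis :: "pseries set" where
  "F_basis = (\<lambda>(n, S). F_set n S) ` F_index"

text \<open>
  The library's \<open>construct\<close> is the linear map with prescribed values on an independent set.
  It is defined on all power series, but only its values on the span of \<open>F_basis\<close> matter.
  The lemmas \<open>linear_vartheta\<close> and \<open>vartheta_F_set\<close> below are its defining properties.
\<close>

definition vartheta :: "pseries \<Rightarrow> pseries" where
  "vartheta = pser_pair.construct F_basis
     (\<lambda>f. case inv_into F_index (\<lambda>(n, S). F_set n S) f of (n, S) \<Rightarrow> Theta_set n (Lambda_set S))"

subsection \<open>The defining properties of \<open>vartheta\<close>\<close>

lemma lookup_sum_single:
  fixes k :: nat and g :: "nat \<Rightarrow> nat"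
  shows "Poly_Mapping.lookup (\<Sum>j<k. Poly_Mapping.single (f j) (g j)) x = (\<Sum>j<k. if f j = x then g j else 0)"
  by (induction k) (auto simp: lookup_add lookup_single when_def)

lemma lookup_index_list:
  assumes "distinct is" "length is = k" "i < k"
  shows "Poly_Mapping.lookup (\<Sum>j<k. Poly_Mapping.single (is ! j) (\<beta> ! j)) (is ! i) = (\<beta> ! i :: nat)"
proof -
  have "(\<Sum>j<k. if is ! j = is ! i then \<beta> ! j else 0) = (\<Sum>j<k. if j = i then \<beta> ! j else 0)"
    using assms by (intro sum.cong) (auto simp: nth_eq_iff_index_eq)
  then show ?thesis
    using assms(3) by (simp add: lookup_sum_single)
qed

lemma keys_index_list:
  fixes \<beta> :: "nat list"
  assumes "distinct is" "length is = length \<beta>" "0 \<notin> set \<beta>"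
  shows "Poly_Mapping.keys (\<Sum>j<length \<beta>. Poly_Mapping.single (is ! j) (\<beta> ! j)) = set is"
proof (intro set_eqI iffI)
  fix x assume "x \<in> Poly_Mapping.keys (\<Sum>j<length \<beta>. Poly_Mapping.single (is ! j) (\<beta> ! j))"
  then have "(\<Sum>j<length \<beta>. if is ! j = x then \<beta> ! j else 0) \<noteq> 0"
    by (simp only: in_keys_iff lookup_sum_single not_False_eq_True)
  then obtain j where "j < length \<beta>" "is ! j = x"
    by (auto elim!: sum.not_neutral_contains_not_neutral split: if_splits)
  then show "x \<in> set is" using assms(2) by auto
next
  fix x assume "x \<in> set is"
  then obtain i where i: "i < length \<beta>" "x = is ! i"
    using assms(2) by (metis in_set_conv_nth)
  then have "\<beta> ! i \<noteq> 0" using assms(3) by (metis nth_mem)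
  then show "x \<in> Poly_Mapping.keys (\<Sum>j<length \<beta>. Poly_Mapping.single (is ! j) (\<beta> ! j))"
    using i lookup_index_list[OF assms(1,2) i(1), of \<beta>] by (simp add: in_keys_iff)
qed

definition initial_monomial :: "nat list \<Rightarrow> nat \<Rightarrow>\<^sub>0 nat" where
  "initial_monomial \<beta> = (\<Sum>j<length \<beta>. Poly_Mapping.single j (\<beta> ! j))"

lemma monomial_qsym_initial_monomial:
  assumes "0 \<notin> set \<beta>" "0 \<notin> set \<gamma>"
  shows "monomial_qsym \<beta> (initial_monomial \<gamma>) = (if \<beta> = \<gamma> then 1 else 0)"
proof -
  have init: "initial_monomial \<gamma> =
      (\<Sum>j<length \<gamma>. Poly_Mapping.single ([0..<length \<gamma>] ! j) (\<gamma> ! j))" for \<gamma>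
    unfolding initial_monomial_def by (intro sum.cong) auto
  have eq: "is = [0..<length \<gamma>] \<and> \<beta> = \<gamma>"
    if s: "sorted_wrt (<) is" and l: "length is = length \<beta>"
      and e: "(\<Sum>j<length \<beta>. Poly_Mapping.single (is ! j) (\<beta> ! j)) = initial_monomial \<gamma>" for "is"
  proof -
    have d: "distinct is" and so: "sorted is"
      using s strict_sorted_iff by blast+
    have e': "(\<Sum>j<length \<beta>. Poly_Mapping.single (is ! j) (\<beta> ! j)) =
        (\<Sum>j<length \<gamma>. Poly_Mapping.single ([0..<length \<gamma>] ! j) (\<gamma> ! j))"
      by (rule trans[OF e init])
    have "set is = set [0..<length \<gamma>]"
      unfolding keys_index_list[OF d l assms(1), symmetric] e'
      by (rule keys_index_list) (use assms(2) in simp_all)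
    then have eq: "is = [0..<length \<gamma>]"
      by (intro sorted_distinct_set_unique) (use d so in simp_all)
    then have len: "length \<beta> = length \<gamma>" using l by simp
    have "\<beta> ! i = \<gamma> ! i" if i: "i < length \<beta>" for i
    proof -
      have "\<beta> ! i = Poly_Mapping.lookup
          (\<Sum>j<length \<gamma>. Poly_Mapping.single ([0..<length \<gamma>] ! j) (\<gamma> ! j)) (is ! i)"
        unfolding e'[symmetric] by (rule lookup_index_list[OF d l i, symmetric])
      also have "\<dots> = \<gamma> ! i"
        unfolding eq by (rule lookup_index_list) (use i len in simp_all)
      finally show ?thesis .
    qed
    then have "\<beta> = \<gamma>" by (intro nth_equalityI len)
    with eq show ?thesis by blast
  qed
  let ?A = "{is. sorted_wrt (<) is \<and> length is = length \<beta> \<and>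
      (\<Sum>j<length \<beta>. Poly_Mapping.single (is ! j) (\<beta> ! j)) = initial_monomial \<gamma>}"
  show ?thesis
  proof (cases "\<beta> = \<gamma>")
    case True
    have "[0..<length \<gamma>] \<in> ?A"
      unfolding True using init[of \<gamma>, symmetric] by (simp del: nth_upt)
    then have "?A = {[0..<length \<gamma>]}"
      using eq by blast
    then show ?thesis using True by (simp only: monomial_qsym_def card_1_singleton_iff) simp
  next
    case False
    then have "?A = {}"
      using eq by blast
    then show ?thesis using False by (simp only: monomial_qsym_def) simp
  qed
qed

lemma successive_diffs_pos: "sorted_wrt (<) (a # xs) \<Longrightarrow> 0 \<notin> set (successive_diffs a xs)"
  by (induction xs arbitrary: a) auto

lemma successive_diffs_inj:
  "sorted_wrt (<) (a # xs) \<Longrightarrow> sorted_wrt (<) (a # ys) \<Longrightarrow>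
    successive_diffs a xs = successive_diffs a ys \<Longrightarrow> xs = ys"
proof (induction xs arbitrary: a ys)
  case Nil
  then show ?case by (cases ys) auto
next
  case (Cons x xs)
  then obtain y ys' where ys: "ys = y # ys'" by (cases ys) auto
  have "x = y" using Cons.prems ys by auto
  moreover have "xs = ys'"
    by (rule Cons.IH[of x]) (use Cons.prems ys \<open>x = y\<close> in simp_all)
  ultimately show ?case using ys by simp
qed

lemma sorted_set_list:
  fixes S :: "nat set"
  assumes "S \<subseteq> {1..n}"
  shows "sorted_wrt (<) (0 # sorted_list_of_set S @ [n + 1])"
proof -
  have "finite S" by (rule finite_subset[OF assms finite_atLeastAtMost])
  then show ?thesis
    using assms by (auto simp: sorted_wrt_append strict_sorted_list_of_set less_Suc_eq_le)
qed

lemma composition_of_set_pos: "S \<subseteq> {1..n} \<Longrightarrow> 0 \<notin> set (composition_of_set n S)"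
  unfolding composition_of_set_def by (intro successive_diffs_pos sorted_set_list)

lemma composition_of_set_inj:
  assumes "S \<subseteq> {1..n}" "T \<subseteq> {1..k}" "composition_of_set n S = composition_of_set k T"
  shows "n = k \<and> S = T"
proof -
  have "sorted_list_of_set S @ [n + 1] = sorted_list_of_set T @ [k + 1]"
    using successive_diffs_inj[OF sorted_set_list[OF assms(1)] sorted_set_list[OF assms(2)]]
      assms(3) by (simp only: composition_of_set_def)
  moreover have "finite S" "finite T"
    by (rule finite_subset[OF assms(1) finite_atLeastAtMost] finite_subset[OF assms(2) finite_atLeastAtMost])+
  ultimately show ?thesis
    by (simp add: sorted_list_of_set_inject)
qed

lemma sum_pseries_apply: "(\<Sum>x\<in>A. f x) m = (\<Sum>x\<in>A. (f x :: pseries) m)"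
  by (induction A rule: infinite_finite_induct) auto

lemma F_set_initial_monomial:
  assumes "S \<subseteq> {1..n}" "T \<subseteq> {1..k}"
  shows "F_set n S (initial_monomial (composition_of_set k T)) = (if n = k \<and> S \<subseteq> T then 1 else 0)"
proof -
  have "F_set n S (initial_monomial (composition_of_set k T))
      = (\<Sum>U | S \<subseteq> U \<and> U \<subseteq> {1..n}. if n = k \<and> U = T then 1 else 0)"
    unfolding F_set_def sum_pseries_apply M_set_def
  proof (intro sum.cong refl)
    fix U assume "U \<in> {U. S \<subseteq> U \<and> U \<subseteq> {1..n}}"
    then have U: "U \<subseteq> {1..n}" by simp
    have "composition_of_set n U = composition_of_set k T \<longleftrightarrow> n = k \<and> U = T"
      using composition_of_set_inj[OF U assms(2)] by blast
    then show "monomial_qsym (composition_of_set n U) (initial_monomial (composition_of_set k T)) =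
        (if n = k \<and> U = T then 1 else 0)"
      by (simp only: monomial_qsym_initial_monomial composition_of_set_pos[OF U]
          composition_of_set_pos[OF assms(2)] not_False_eq_True)
  qed
  also have "\<dots> = (\<Sum>U | S \<subseteq> U \<and> U \<subseteq> {1..n}. if U = T then (if n = k then 1 else 0) else 0)"
    by (intro sum.cong) auto
  also have "\<dots> = (if n = k \<and> S \<subseteq> T then 1 else 0)"
    using assms by (subst sum.delta) auto
  finally show ?thesis .
qed

lemma F_set_inj: "inj_on (\<lambda>(n, S). F_set n S) F_index"
proof (rule inj_onI)
  fix p q
  assume p: "p \<in> F_index" and q: "q \<in> F_index"
    and e: "(\<lambda>(n, S). F_set n S) p = (\<lambda>(n, S). F_set n S) q"
  obtain n S k T where nS: "p = (n, S)" and kT: "q = (k, T)" by (cases p, cases q)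
  have S: "S \<subseteq> {1..n}" and T: "T \<subseteq> {1..k}" and e': "F_set n S = F_set k T"
    using p q e unfolding nS kT F_index_def by simp_all
  have "(if n = k \<and> S \<subseteq> T then 1 else 0) = (1::rat)"
    unfolding F_set_initial_monomial[OF S T, symmetric] e' F_set_initial_monomial[OF T T] by simp
  moreover have "(if k = n \<and> T \<subseteq> S then 1 else 0) = (1::rat)"
    unfolding F_set_initial_monomial[OF T S, symmetric] e'[symmetric] F_set_initial_monomial[OF S S]
    by simp
  ultimately have "n = k \<and> S = T" by (auto split: if_splits)
  then show "p = q" using nS kT by simp
qed

lemma F_basis_independent: "pser.independent F_basis"
proof -
  have "u v = 0"
    if fin: "finite t" and sub: "t \<subseteq> F_basis" and z: "(\<Sum>v\<in>t. u v *\<^sub>q v) = 0" and v: "v \<in> t"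
    for t u v
  proof (rule ccontr)
    assume nz: "u v \<noteq> 0"
    define I where "I = {p \<in> F_index. (case p of (n, S) \<Rightarrow> F_set n S) \<in> t}"
    define c where "c = (\<lambda>(n, S). u (F_set n S))"
    have bij: "bij_betw (\<lambda>(n, S). F_set n S) I t"
      unfolding bij_betw_def
    proof
      show "inj_on (\<lambda>(n, S). F_set n S) I"
        by (rule inj_on_subset[OF F_set_inj]) (auto simp only: I_def)
      show "(\<lambda>(n, S). F_set n S) ` I = t"
      proof (intro equalityI subsetI)
        fix x assume "x \<in> (\<lambda>(n, S). F_set n S) ` I"
        then show "x \<in> t" by (auto simp only: I_def)
      next
        fix x assume x: "x \<in> t"
        then obtain p where "p \<in> F_index" "x = (\<lambda>(n, S). F_set n S) p"
          using sub unfolding F_basis_def by (meson imageE subsetD)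
        then show "x \<in> (\<lambda>(n, S). F_set n S) ` I"
          using x unfolding I_def by (intro image_eqI[of _ _ p]) simp_all
      qed
    qed
    have finI: "finite I" using bij_betw_finite[OF bij] fin by simp
    obtain p0 where p0: "p0 \<in> I" "(\<lambda>(n, S). F_set n S) p0 = v"
      using bij v unfolding bij_betw_def by blast
    then have "c p0 \<noteq> 0" using nz by (cases p0) (simp add: c_def)
    then obtain p where p: "p \<in> I" "c p \<noteq> 0"
      and pmin: "\<And>q. q \<in> I \<Longrightarrow> c q \<noteq> 0 \<Longrightarrow> card (snd p) \<le> card (snd q)"
      using p0(1) ex_has_least_nat[of "\<lambda>p. p \<in> I \<and> c p \<noteq> 0" p0 "\<lambda>p. card (snd p)"]
      by blast
    obtain k T where kT: "p = (k, T)" by (cases p)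
    have T: "T \<subseteq> {1..k}" using p kT by (auto simp: I_def F_index_def)
    have zero: "c q * (case q of (n, S) \<Rightarrow> F_set n S) (initial_monomial (composition_of_set k T)) =
        (if q = p then c p else 0)" if q: "q \<in> I" for q
    proof -
      obtain n S where nS: "q = (n, S)" by (cases q)
      have S: "S \<subseteq> {1..n}" using q nS by (auto simp: I_def F_index_def)
      have "S = T" if "S \<subseteq> T" "c q \<noteq> 0"
        using card_seteq[OF finite_subset[OF T finite_atLeastAtMost] that(1)]
          pmin[OF q that(2)] nS kT by simp
      then show ?thesis
        using F_set_initial_monomial[OF S T] nS kT by (cases "c q = 0") auto
    qed
    have "0 = (\<Sum>v\<in>t. u v *\<^sub>q v) (initial_monomial (composition_of_set k T))"
      using z by simp
    also have "\<dots> = (\<Sum>v\<in>t. u v * v (initial_monomial (composition_of_set k T)))"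
      by (simp add: sum_pseries_apply scale_def)
    also have "\<dots> = (\<Sum>q\<in>I. c q * (case q of (n, S) \<Rightarrow> F_set n S) (initial_monomial (composition_of_set k T)))"
      by (subst sum.reindex_bij_betw[OF bij, symmetric]) (simp add: c_def case_prod_beta)
    also have "\<dots> = (\<Sum>q\<in>I. if q = p then c p else 0)"
      by (intro sum.cong refl zero)
    also have "\<dots> = c p" using p finI by simp
    finally show False using p by simp
  qed
  then show ?thesis by (simp only: pser.independent_explicit_module) blast
qed

lemma linear_vartheta: "Vector_Spaces.linear scale scale vartheta"
  unfolding vartheta_def by (intro pser_pair.linear_construct F_basis_independent)

lemma vartheta_F_set:
  assumes "S \<subseteq> {1..n}"
  shows "vartheta (F_set n S) = Theta_set n (Lambda_set S)"
proof -
  have i: "(n, S) \<in> F_index" using assms by (simp add: F_index_def)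
  then have "F_set n S \<in> F_basis" by (force simp: F_basis_def)
  moreover have "inv_into F_index (\<lambda>(n, S). F_set n S) (F_set n S) = (n, S)"
    using inv_into_f_f[OF F_set_inj i] by simp
  ultimately show ?thesis
    unfolding vartheta_def by (simp add: pser_pair.construct_basis[OF F_basis_independent])
qed


section \<open>Graded posets\<close>

text \<open>
  A poset is given by its (reflexive) order relation \<open>r\<close>; its elements are \<open>Field r\<close>, and
  its chains are \<open>Chains r\<close> (the empty chain included).
\<close>

definition maximal_chains :: "'a rel \<Rightarrow> 'a set set" where
  "maximal_chains r = {C \<in> Chains r. \<forall>D \<in> Chains r. C \<subseteq> D \<longrightarrow> D = C}"

definition graded_poset :: "'a rel \<Rightarrow> bool" where
  "graded_poset r \<longleftrightarrow> Partial_order r \<and> finite (Field r) \<and>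
     (\<exists>!z. z \<in> Field r \<and> (\<forall>x. (x, z) \<in> r \<longrightarrow> x = z)) \<and>
     (\<exists>!z. z \<in> Field r \<and> (\<forall>x. (z, x) \<in> r \<longrightarrow> x = z)) \<and>
     (\<forall>C \<in> maximal_chains r. \<forall>D \<in> maximal_chains r. card C = card D)"

definition poset_rank :: "'a rel \<Rightarrow> nat" where
  "poset_rank r = Max (card ` Chains r) - 1"

definition elem_rank :: "'a rel \<Rightarrow> 'a \<Rightarrow> nat" where
  "elem_rank r x = Max (card ` {C \<in> Chains r. C \<subseteq> under r x}) - 1"

definition flag_f :: "'a rel \<Rightarrow> nat set \<Rightarrow> nat" where
  "flag_f r S = card {C \<in> Chains r. elem_rank r ` C = S}"

text \<open>\<open>F(P)\<close>, for a graded poset of positive rank \<open>n + 1\<close>.\<close>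

definition qsym_of_poset :: "'a rel \<Rightarrow> pseries" where
  "qsym_of_poset r = (let n = poset_rank r - 1 in
     \<Sum>S | S \<subseteq> {1..n}. of_nat (flag_f r S) *\<^sub>q M_set n S)"

definition adjoin_bot :: "'a rel \<Rightarrow> 'a option rel" where
  "adjoin_bot r = insert (None, None) ({None} \<times> Some ` Field r \<union> map_prod Some Some ` r)"

definition adjoin_top :: "'a rel \<Rightarrow> 'a option rel" where
  "adjoin_top r = insert (None, None) (Some ` Field r \<times> {None} \<union> map_prod Some Some ` r)"

definition poset_isomorphic :: "'a rel \<Rightarrow> 'b rel \<Rightarrow> bool" where
  "poset_isomorphic r s \<longleftrightarrow> (\<exists>f. bij_betw f (Field r) (Field s) \<and>
     (\<forall>x \<in> Field r. \<forall>y \<in> Field r. (x, y) \<in> r \<longleftrightarrow> (f x, f y) \<in> s))"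


section \<open>Oriented matroids\<close>

text \<open>
  Sign vectors on the ground set \<open>E\<close> are functions into \<open>{-1, 0, 1}\<close>, taken to be 0 outside \<open>E\<close>
  so that distinct functions are distinct sign vectors.
\<close>

type_synonym 'e sign_vector = "'e \<Rightarrow> int"

definition sign_vectors :: "'e set \<Rightarrow> 'e sign_vector set" where
  "sign_vectors E = {X. (\<forall>e. X e \<in> {-1, 0, 1}) \<and> (\<forall>e. e \<notin> E \<longrightarrow> X e = 0)}"

definition sv_support :: "'e sign_vector \<Rightarrow> 'e set" where
  "sv_support X = {e. X e \<noteq> 0}"

definition sv_compose :: "'e sign_vector \<Rightarrow> 'e sign_vector \<Rightarrow> 'e sign_vector" where
  "sv_compose X Y = (\<lambda>e. if X e \<noteq> 0 then X e else Y e)"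

definition sv_separation :: "'e sign_vector \<Rightarrow> 'e sign_vector \<Rightarrow> 'e set" where
  "sv_separation X Y = {e. X e \<noteq> 0 \<and> X e = - Y e}"

text \<open>Covector axioms.\<close>

definition oriented_matroid :: "'e set \<Rightarrow> 'e sign_vector set \<Rightarrow> bool" where
  "oriented_matroid E \<L> \<longleftrightarrow> finite E \<and> \<L> \<subseteq> sign_vectors E \<and>
     (\<lambda>e. 0) \<in> \<L> \<and>
     (\<forall>X \<in> \<L>. (\<lambda>e. - X e) \<in> \<L>) \<and>
     (\<forall>X \<in> \<L>. \<forall>Y \<in> \<L>. sv_compose X Y \<in> \<L>) \<and>
     (\<forall>X \<in> \<L>. \<forall>Y \<in> \<L>. \<forall>e \<in> sv_separation X Y.
        \<exists>Z \<in> \<L>. Z e = 0 \<and> (\<forall>f \<in> E - sv_separation X Y. Z f = sv_compose X Y f))"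

text \<open>
  The underlying matroid is the one whose cocircuits are the minimal nonempty supports of covectors
  (the supports of the signed cocircuits).  As in any matroid, its bases are the minimal sets
  meeting every cocircuit; rank and flats are then the usual ones.
\<close>

definition cocircuits :: "'e sign_vector set \<Rightarrow> 'e set set" where
  "cocircuits \<L> = {D \<in> sv_support ` \<L> - {{}}. \<forall>D' \<in> sv_support ` \<L> - {{}}. D' \<subseteq> D \<longrightarrow> D' = D}"

definition matroid_bases :: "'e set \<Rightarrow> 'e sign_vector set \<Rightarrow> 'e set set" where
  "matroid_bases E \<L> = {B. B \<subseteq> E \<and> (\<forall>D \<in> cocircuits \<L>. B \<inter> D \<noteq> {}) \<and>
     (\<forall>B'. B' \<subset> B \<longrightarrow> (\<exists>D \<in> cocircuits \<L>. B' \<inter> D = {}))}"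

definition matroid_rank :: "'e set \<Rightarrow> 'e sign_vector set \<Rightarrow> 'e set \<Rightarrow> nat" where
  "matroid_rank E \<L> A = Max ((\<lambda>B. card (A \<inter> B)) ` matroid_bases E \<L>)"

definition flats :: "'e set \<Rightarrow> 'e sign_vector set \<Rightarrow> 'e set set" where
  "flats E \<L> = {A. A \<subseteq> E \<and> (\<forall>e \<in> E - A. matroid_rank E \<L> A < matroid_rank E \<L> (insert e A))}"

definition geometric_lattice :: "'e set \<Rightarrow> 'e sign_vector set \<Rightarrow> 'e set rel" where
  "geometric_lattice E \<L> = {(A, B). A \<in> flats E \<L> \<and> B \<in> flats E \<L> \<and> A \<subseteq> B}"

definition covector_poset :: "'e sign_vector set \<Rightarrow> 'e sign_vector rel" where
  "covector_poset \<L> = {(X, Y). X \<in> \<L> \<and> Y \<in> \<L> \<and> (\<forall>e. X e = 0 \<or> X e = Y e)}"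

definition face_lattice :: "'e sign_vector set \<Rightarrow> 'e sign_vector option rel" where
  "face_lattice \<L> = adjoin_top (covector_poset \<L>)"

definition dual_face_lattice :: "'e sign_vector set \<Rightarrow> 'e sign_vector option rel" where
  "dual_face_lattice \<L> = (face_lattice \<L>)\<inverse>"


section \<open>Hyperplane arrangements and polytopes\<close>

definition normal_vector :: "'a::euclidean_space \<Rightarrow> 'a set \<Rightarrow> bool" where
  "normal_vector v H \<longleftrightarrow> v \<noteq> 0 \<and> H = {x. v \<bullet> x = 0}"

text \<open>
  The covectors of the arrangement with normals \<open>v e\<close>, for \<open>e \<in> E\<close>: the positions of the
  points of the space with respect to the hyperplanes.
\<close>

definition arrangement_covectors ::
    "'e set \<Rightarrow> ('e \<Rightarrow> 'a::euclidean_space) \<Rightarrow> 'e sign_vector set" where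
  "arrangement_covectors E v =
     range (\<lambda>x e. if e \<in> E then (if v e \<bullet> x > 0 then 1 else if v e \<bullet> x < 0 then -1 else 0) else 0)"

definition polytope_face_lattice :: "'a::euclidean_space set \<Rightarrow> 'a set rel" where
  "polytope_face_lattice P = {(F, G). F face_of P \<and> G face_of P \<and> F \<subseteq> G}"

end

theory Submission
  imports Defs
begin

text \<open>
  Write \<open>L\<^sub>0\<close> for the lattice of flats with a new minimum, \<open>Z\<close> for the dual face lattice and \<open>n\<close> for the
  rank of the matroid, so that both posets have rank \<open>n + 1\<close>. The proof compares, for each
  \<open>U \<subseteq> {1..n}\<close>, the coefficients of \<open>M\<^sub>U\<close> on the two sides, and finds both to be a sum over the flags
  \<open>x\<^sub>1 < \<dots> < x\<^sub>k\<close> of flats with rank set \<open>U\<close>, of a product with one factor for each step of the flag.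

  On the side of \<open>Z\<close> this is a count of fibres. Sending a covector to its zero set is a rank preserving
  map from \<open>Z\<close> to \<open>L\<^sub>0\<close>, so a chain of faces with rank set \<open>U\<close> lies over such a flag. Choosing its
  covectors from the largest flat downwards, the number of choices for the next covector is the
  number of covectors with zero set \<open>x\<close> that extend a given covector \<open>X\<close>, and this turns out to depend
  on \<open>x\<close> and the zero set of \<open>X\<close> only.

  On the side of \<open>L\<^sub>0\<close>, inverting the change of basis from \<open>M\<close> to \<open>F\<close> gives
  \<open>\<vartheta>(M\<^sub>S) = \<Sum>\<^sub>U 2\<^bsup>|U| + 1\<^esup> c(S, U) M\<^sub>U\<close>, where \<open>c(S, U)\<close> (\<open>theta_coeff\<close>) is an alternating sum over the
  sets \<open>T \<supseteq> S\<close> with \<open>\<Lambda>(T) \<subseteq> U \<union> (U + 1)\<close>. That condition does not constrain the membership of the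
  elements of \<open>U\<close> in \<open>T\<close>, so \<open>c(S, U) = 0\<close> unless \<open>U \<subseteq> S\<close>, and in that case it constrains the
  pieces of \<open>T\<close> between the elements of \<open>U\<close> independently of each other: each piece has to be an initial
  segment of its interval. Hence the sum of \<open>c\<close> over all chains of \<open>L\<^sub>0\<close> factors along the flags with
  rank set \<open>U\<close> into gap weights, the gap weight of \<open>x < y\<close> being an alternating sum over the
  chains strictly between \<open>x\<close> and \<open>y\<close> (\<open>weight_rec\<close>).

  It remains to see that a fibre has twice as many elements as the gap weight says (\<open>card_fibre\<close>); the
  factor \<open>2\<^bsup>|U|\<^esup>\<close> absorbs these twos, and the gap below the smallest flat of the flag has weight 1.
  Removing the least element of a chain gives a recursion for gap weights (\<open>gap_weight_rec\<close>), and the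
  fibre sizes satisfy the same recursion by Euler's relation for the covectors in the star of \<open>X\<close>
  (\<open>euler_relation\<close>). In this form the theorem of Las Vergnas and Zaslavsky, which counts the topes of a
  minor by values of the Moebius function, is needed only as an equality of two recursions.

  For an arrangement, a covector \<open>X\<close> of the arrangement is sent to the face of the zonotope on which
  the linear functionals with sign vector \<open>X\<close> are maximal.
\<close>

section \<open>The map \<open>vartheta\<close> on monomial quasisymmetric functions\<close>

lemma alternating_sum_toggle:
  assumes fin: "finite \<T>" "\<And>T. T \<in> \<T> \<Longrightarrow> finite T"
    and ins: "\<And>T. T \<in> \<T> \<Longrightarrow> u \<notin> T \<Longrightarrow> insert u T \<in> \<T>"
    and del: "\<And>T. T \<in> \<T> \<Longrightarrow> u \<in> T \<Longrightarrow> T - {u} \<in> \<T>"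
  shows "(\<Sum>T\<in>\<T>. (-1) ^ card T) = (0::rat)"
proof -
  define h where "h T = (if u \<in> T then T - {u} else insert u T)" for T
  have "(\<Sum>T\<in>\<T>. (-1::rat) ^ card T) = (\<Sum>T\<in>\<T>. - ((-1) ^ card T))"
  proof (rule sum.reindex_bij_witness[of _ h h])
    fix T assume T: "T \<in> \<T>"
    show "h (h T) = T" by (auto simp: h_def)
    then show "h (h T) = T" .
    show "h T \<in> \<T>" using ins del T by (auto simp: h_def)
    then show "h T \<in> \<T>" .
    show "- ((-1) ^ card (h T)) = (-1::rat) ^ card T"
    proof (cases "u \<in> T")
      case True
      then have "card T = Suc (card (h T))"
        using fin(2)[OF T] card.remove[of T u] by (simp add: h_def)
      then show ?thesis by simp
    qed (use fin(2)[OF T] in \<open>simp add: h_def\<close>)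
  qed
  then show ?thesis by (simp add: sum_negf)
qed

lemma alternating_sum_between:
  assumes "finite V"
  shows "(\<Sum>T | S \<subseteq> T \<and> T \<subseteq> V. (-1) ^ (card T + card S)) = (if S = V then 1 else 0 :: rat)"
proof (cases "S \<subseteq> V \<and> S \<noteq> V")
  case True
  then obtain u where u: "u \<in> V" "u \<notin> S" by blast
  have "(\<Sum>T | S \<subseteq> T \<and> T \<subseteq> V. (-1::rat) ^ card T) = 0"
    by (rule alternating_sum_toggle[of _ u]) (use assms u finite_subset in auto)
  then show ?thesis using True by (auto simp: power_add simp flip: sum_distrib_right)
next
  case False
  then have "{T. S \<subseteq> T \<and> T \<subseteq> V} = (if S = V then {V} else {})" by auto
  then show ?thesis by (simp flip: power2_eq_square mult_2)
qed

text \<open>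
  Up to the factor \<open>2\<^bsup>|U| + 1\<^esup>\<close>, this is the coefficient of \<open>M\<^sub>U\<close> in \<open>\<vartheta>(M\<^sub>S)\<close>.
\<close>

definition theta_coeff :: "nat \<Rightarrow> nat set \<Rightarrow> nat set \<Rightarrow> rat" where
  "theta_coeff n S U = (\<Sum>T | S \<subseteq> T \<and> T \<subseteq> {1..n} \<and> Lambda_set T \<subseteq> U \<union> (\<lambda>i. i + 1) ` U.
     (-1) ^ (card T + card S))"

text \<open>
  The contribution of one piece between consecutive elements of \<open>U\<close>: the alternating sum over the
  initial segments \<open>{a<..j}\<close> of \<open>{a<..n}\<close> that contain \<open>S\<close>. The sign \<open>(-1)\<^bsup>j + a\<^esup>\<close> stands for
  \<open>(-1)\<^bsup>j - a\<^esup>\<close> and avoids truncated subtraction.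
\<close>

definition prefix_coeff :: "nat \<Rightarrow> nat \<Rightarrow> nat set \<Rightarrow> rat" where
  "prefix_coeff a n S = (\<Sum>j | a \<le> j \<and> j \<le> n \<and> (\<forall>s\<in>S. s \<le> j). (-1) ^ (j + a + card S))"

lemma pser_sum_apply: "(\<Sum>x\<in>A. c x *\<^sub>q f x) m = (\<Sum>x\<in>A. c x * f x m)"
  by (simp add: sum_pseries_apply scale_def)

text \<open>
  Moebius inversion over the subsets of \<open>{1..n}\<close>.
\<close>

lemma M_set_eq_sum_F_set:
  assumes "S \<subseteq> {1..n}"
  shows "M_set n S = (\<Sum>T | S \<subseteq> T \<and> T \<subseteq> {1..n}. (-1) ^ (card T + card S) *\<^sub>q F_set n T)"
proof
  fix m
  let ?I = "{T. S \<subseteq> T \<and> T \<subseteq> {1..n}}"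
  have "(\<Sum>T\<in>?I. (-1) ^ (card T + card S) *\<^sub>q F_set n T) m
      = (\<Sum>T\<in>?I. \<Sum>V | T \<subseteq> V \<and> V \<subseteq> {1..n}. (-1) ^ (card T + card S) * M_set n V m)"
    by (simp add: pser_sum_apply F_set_def sum_pseries_apply sum_distrib_left)
  also have "\<dots> = (\<Sum>T\<in>?I. \<Sum>V | V \<in> ?I \<and> T \<subseteq> V. (-1) ^ (card T + card S) * M_set n V m)"
    by (intro sum.cong refl) auto
  also have "\<dots> = (\<Sum>V\<in>?I. \<Sum>T | T \<in> ?I \<and> T \<subseteq> V. (-1) ^ (card T + card S) * M_set n V m)"
    by (rule sum.swap_restrict) auto
  also have "\<dots> = (\<Sum>V\<in>?I. if S = V then M_set n V m else 0)"
  proof (rule sum.cong[OF refl])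
    fix V assume V: "V \<in> ?I"
    then have fV: "finite V" using finite_subset by blast
    have eq: "{T \<in> ?I. T \<subseteq> V} = {T. S \<subseteq> T \<and> T \<subseteq> V}" using V by auto
    show "(\<Sum>T | T \<in> ?I \<and> T \<subseteq> V. (-1) ^ (card T + card S) * M_set n V m)
        = (if S = V then M_set n V m else 0)"
      unfolding eq sum_distrib_right[symmetric] alternating_sum_between[OF fV] by simp
  qed
  also have "\<dots> = M_set n S m" using assms by simp
  finally show "M_set n S m = (\<Sum>T\<in>?I. (-1) ^ (card T + card S) *\<^sub>q F_set n T) m" by simp
qed

lemma vartheta_sum: "vartheta (\<Sum>x\<in>A. c x *\<^sub>q f x) = (\<Sum>x\<in>A. c x *\<^sub>q vartheta (f x))"
proof -
  interpret module_hom scale scale vartheta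
    using linear_vartheta by (simp add: linear_iff_module_hom)
  show ?thesis by (simp add: sum scale)
qed

lemma vartheta_sum_M_set:
  "vartheta (\<Sum>S | S \<subseteq> {1..n}. f S *\<^sub>q M_set n S) =
    (\<Sum>U | U \<subseteq> {1..n}.
      (2 ^ (card U + 1) * (\<Sum>S | S \<subseteq> {1..n}. f S * theta_coeff n S U)) *\<^sub>q M_set n U)"
proof
  fix m
  let ?P = "{S. S \<subseteq> {1..n}}"
  let ?ok = "\<lambda>T U. Lambda_set T \<subseteq> U \<union> (\<lambda>i. i + 1) ` U"
  have vM: "vartheta (M_set n S) m = (\<Sum>U\<in>?P. 2 ^ (card U + 1) * theta_coeff n S U * M_set n U m)"
    if S: "S \<in> ?P" for S
  proof -
    let ?I = "{T. S \<subseteq> T \<and> T \<subseteq> {1..n}}"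
    have "vartheta (M_set n S) = (\<Sum>T\<in>?I. (-1) ^ (card T + card S) *\<^sub>q Theta_set n (Lambda_set T))"
      using S by (simp add: M_set_eq_sum_F_set vartheta_sum vartheta_F_set)
    then have "vartheta (M_set n S) m = (\<Sum>T\<in>?I. \<Sum>U | U \<in> ?P \<and> ?ok T U.
        (-1) ^ (card T + card S) * (2 ^ (card U + 1) * M_set n U m))"
      by (simp add: pser_sum_apply Theta_set_def sum_distrib_left)
    also have "\<dots> = (\<Sum>U\<in>?P. \<Sum>T | T \<in> ?I \<and> ?ok T U.
        (-1) ^ (card T + card S) * (2 ^ (card U + 1) * M_set n U m))"
      by (rule sum.swap_restrict) auto
    also have "\<dots> = (\<Sum>U\<in>?P. 2 ^ (card U + 1) * theta_coeff n S U * M_set n U m)"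
      by (intro sum.cong refl)
        (simp add: theta_coeff_def sum_distrib_left sum_distrib_right mult_ac conj_assoc)
    finally show ?thesis .
  qed
  have "vartheta (\<Sum>S\<in>?P. f S *\<^sub>q M_set n S) m
      = (\<Sum>S\<in>?P. \<Sum>U\<in>?P. f S * (2 ^ (card U + 1) * theta_coeff n S U * M_set n U m))"
    unfolding vartheta_sum pser_sum_apply by (intro sum.cong refl) (simp only: vM sum_distrib_left)
  also have "\<dots> = (\<Sum>U\<in>?P. \<Sum>S\<in>?P. f S * (2 ^ (card U + 1) * theta_coeff n S U * M_set n U m))"
    by (rule sum.swap)
  also have "\<dots> = (\<Sum>U\<in>?P. (2 ^ (card U + 1) * (\<Sum>S\<in>?P. f S * theta_coeff n S U)) *\<^sub>q M_set n U) m"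
    unfolding pser_sum_apply by (intro sum.cong refl) (simp add: sum_distrib_left sum_distrib_right mult_ac)
  finally show "vartheta (\<Sum>S\<in>?P. f S *\<^sub>q M_set n S) m = \<dots>" .
qed

lemma prefix_coeff_empty:
  assumes "a \<le> n"
  shows "prefix_coeff a n {} = (if even (n - a) then 1 else 0)"
proof -
  have eq: "{j. a \<le> j \<and> j \<le> n \<and> (\<forall>s\<in>{}. s \<le> j)} = {a..n}" by auto
  have "(\<Sum>j\<in>{a..n}. (-1::rat) ^ (j + a)) = (if even (n - a) then 1 else 0)"
    using assms
  proof (induction n rule: dec_induct)
    case base
    then show ?case by (simp flip: mult_2)
  next
    case (step n)
    then have "even (Suc n - a) \<longleftrightarrow> odd (n - a)" "even (n + a) \<longleftrightarrow> even (n - a)" by (simp_all add: Suc_diff_le)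
    with step show ?case by (simp add: uminus_power_if)
  qed
  then show ?thesis unfolding prefix_coeff_def eq by simp
qed

lemma Lambda_set_subset_iff: "Lambda_set T \<subseteq> V \<longleftrightarrow> (\<forall>i\<in>T. i = 1 \<or> i - 1 \<in> T \<or> i \<in> V)"
  by (auto simp: Lambda_set_def)

text \<open>
  A set without ascents inside \<open>{a<..n}\<close> is an initial segment; these are the pieces that the
  condition on \<open>\<Lambda>(T)\<close> allows between two elements of \<open>U\<close>.
\<close>

lemma downward_closed_interval:
  fixes T :: "nat set"
  assumes "T \<subseteq> {a<..n}" "a \<le> n" and down: "\<And>i. i \<in> T \<Longrightarrow> i = a + 1 \<or> i - 1 \<in> T"
  shows "\<exists>j. a \<le> j \<and> j \<le> n \<and> T = {a<..j}"
proof (cases "T = {}")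
  case True
  then show ?thesis using assms(2) by (intro exI[of _ a]) auto
next
  case False
  have fin: "finite T" using assms(1) finite_subset by blast
  define j where "j = Max T"
  have j: "j \<in> T" "\<And>i. i \<in> T \<Longrightarrow> i \<le> j" using False fin by (auto simp: j_def)
  have "j - k \<in> T" if "a < j - k" for k
    using that
  proof (induction k)
    case (Suc k)
    then show ?case using down[of "j - k"] by (auto simp: Suc_diff_Suc)
  qed (use j in simp)
  then have "i \<in> T" if "a < i" "i \<le> j" for i
    using that by (metis diff_diff_cancel)
  then have "T = {a<..j}" using assms(1) j by auto
  then show ?thesis using assms(1) j by (intro exI[of _ j]) auto
qed

lemma theta_coeff_empty:
  assumes "S \<subseteq> {1..n}"
  shows "theta_coeff n S {} = prefix_coeff 0 n S"
  unfolding theta_coeff_def prefix_coeff_def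
proof (rule sum.reindex_bij_witness[of _ "\<lambda>j. {0<..j}" card])
  fix T assume "T \<in> {T. S \<subseteq> T \<and> T \<subseteq> {1..n} \<and> Lambda_set T \<subseteq> {} \<union> (\<lambda>i. i + 1) ` {}}"
  then have T: "S \<subseteq> T" "T \<subseteq> {0<..n}" "\<And>i. i \<in> T \<Longrightarrow> i = 0 + 1 \<or> i - 1 \<in> T"
    unfolding Lambda_set_subset_iff by auto
  obtain j where j: "j \<le> n" "T = {0<..j}" using downward_closed_interval[OF T(2) _ T(3)] by auto
  show "{0<..card T} = T" using j by simp
  show "card T \<in> {j. 0 \<le> j \<and> j \<le> n \<and> (\<forall>s\<in>S. s \<le> j)}" using j T(1) by auto
  show "(-1::rat) ^ (card T + 0 + card S) = (-1) ^ (card T + card S)" by simp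
next
  fix j assume "j \<in> {j. 0 \<le> j \<and> j \<le> n \<and> (\<forall>s\<in>S. s \<le> j)}"
  then show "card {0<..j} = j"
    "{0<..j} \<in> {T. S \<subseteq> T \<and> T \<subseteq> {1..n} \<and> Lambda_set T \<subseteq> {} \<union> (\<lambda>i. i + 1) ` {}}"
    using assms unfolding Lambda_set_subset_iff by auto
qed

text \<open>
  Adding \<open>u\<close> to \<open>T\<close> or removing it changes \<open>\<Lambda>(T)\<close> only at \<open>u\<close> and \<open>u + 1\<close>, which both belong to
  \<open>U \<union> (U + 1)\<close>. So \<open>T\<close> ranges over a family that is closed under toggling \<open>u\<close>, and the
  terms cancel in pairs.
\<close>

lemma theta_coeff_eq_0:
  assumes "u \<in> U" "u \<in> {1..n}" "u \<notin> S"
  shows "theta_coeff n S U = 0"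
proof -
  have "(\<Sum>T | S \<subseteq> T \<and> T \<subseteq> {1..n} \<and> Lambda_set T \<subseteq> U \<union> (\<lambda>i. i + 1) ` U. (-1::rat) ^ card T) = 0"
  proof (rule alternating_sum_toggle[of _ u])
    fix T assume T: "T \<in> {T. S \<subseteq> T \<and> T \<subseteq> {1..n} \<and> Lambda_set T \<subseteq> U \<union> (\<lambda>i. i + 1) ` U}"
    then have L: "\<forall>i\<in>T. i = 1 \<or> i - 1 \<in> T \<or> i \<in> U \<union> (\<lambda>i. i + 1) ` U"
      unfolding Lambda_set_subset_iff by blast
    show "finite T" using T finite_subset by blast
    show "insert u T \<in> {T. S \<subseteq> T \<and> T \<subseteq> {1..n} \<and> Lambda_set T \<subseteq> U \<union> (\<lambda>i. i + 1) ` U}"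
      using T L assms unfolding Lambda_set_subset_iff by auto
    have "i = 1 \<or> i - 1 \<in> T - {u} \<or> i \<in> U \<union> (\<lambda>i. i + 1) ` U" if "i \<in> T" for i
    proof (cases "i = u + 1")
      case True
      then show ?thesis using assms(1) by blast
    next
      case False
      have "i \<ge> 1" using that T by auto
      then have "i - 1 \<noteq> u" using False by linarith
      then show ?thesis using L that by blast
    qed
    then show "T - {u} \<in> {T. S \<subseteq> T \<and> T \<subseteq> {1..n} \<and> Lambda_set T \<subseteq> U \<union> (\<lambda>i. i + 1) ` U}"
      using T assms(3) unfolding Lambda_set_subset_iff by blast
  qed simp
  then show ?thesis by (simp add: theta_coeff_def power_add flip: sum_distrib_right)
qed

text \<open>
  Here \<open>u\<close> is the largest element of \<open>U\<close>. Nothing above \<open>u + 1\<close> may start a new run of \<open>T\<close>, so the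
  part of \<open>T\<close> above \<open>u\<close> is an initial segment \<open>{u<..j}\<close>, while the part of \<open>T\<close> below \<open>u\<close> satisfies the same
  condition with \<open>U - {u}\<close> in place of \<open>U\<close>. Since \<open>u \<in> T\<close>, the number \<open>j\<close> is the maximum of \<open>T\<close>.
\<close>

lemma theta_coeff_split:
  assumes U: "U \<subseteq> {1..n}" and u: "u \<in> U" "\<And>v. v \<in> U \<Longrightarrow> v \<le> u" and S: "S \<subseteq> {1..n}" "u \<in> S"
  shows "theta_coeff n S U =
    theta_coeff (u - 1) (S \<inter> {..<u}) (U - {u}) * prefix_coeff u n (S \<inter> {u<..})"
proof -
  let ?V = "U \<union> (\<lambda>i. i + 1) ` U" and ?V' = "(U - {u}) \<union> (\<lambda>i. i + 1) ` (U - {u})"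
  let ?I = "{T. S \<inter> {..<u} \<subseteq> T \<and> T \<subseteq> {1..u-1} \<and> Lambda_set T \<subseteq> ?V'}"
  let ?J = "{j. u \<le> j \<and> j \<le> n \<and> (\<forall>s\<in>S \<inter> {u<..}. s \<le> j)}"
  have un: "1 \<le> u" "u \<le> n" using U u by auto
  have finS: "finite S" using S(1) finite_subset by blast
  have Sdec: "S = (S \<inter> {..<u}) \<union> {u} \<union> (S \<inter> {u<..})" using S(2) by auto
  have cS: "card S = card (S \<inter> {..<u}) + 1 + card (S \<inter> {u<..})"
    by (subst Sdec, subst card_Un_disjoint, use finS in simp, use finS in simp, force,
        subst card_Un_disjoint, use finS in auto)
  have "theta_coeff n S U = (\<Sum>(T, j)\<in>?I \<times> ?J.
      (-1) ^ (card T + card (S \<inter> {..<u})) * (-1) ^ (j + u + card (S \<inter> {u<..})))"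
    unfolding theta_coeff_def
  proof (rule sum.reindex_bij_witness[of _ "\<lambda>(T, j). T \<union> {u..j}" "\<lambda>T. (T \<inter> {..<u}, Max T)"])
    fix T assume "T \<in> {T. S \<subseteq> T \<and> T \<subseteq> {1..n} \<and> Lambda_set T \<subseteq> ?V}"
    then have T: "S \<subseteq> T" "T \<subseteq> {1..n}" "\<And>i. i \<in> T \<Longrightarrow> i = 1 \<or> i - 1 \<in> T \<or> i \<in> ?V"
      unfolding Lambda_set_subset_iff by auto
    have finT: "finite T" using T(2) finite_subset by blast
    have uT: "u \<in> T" using T S by auto
    have nV: "i \<notin> ?V" if "i > u + 1" for i
      using that u(2) by fastforce
    have "\<exists>j. u \<le> j \<and> j \<le> n \<and> T \<inter> {u<..} = {u<..j}"
    proof (rule downward_closed_interval)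
      fix i assume i: "i \<in> T \<inter> {u<..}"
      show "i = u + 1 \<or> i - 1 \<in> T \<inter> {u<..}"
        using T(3)[of i] nV[of i] i un by (cases "i = u + 1") auto
    qed (use T un in auto)
    then obtain j where j: "u \<le> j" "j \<le> n" "T \<inter> {u<..} = {u<..j}" by blast
    have "T = (T \<inter> {..<u}) \<union> ({u} \<union> (T \<inter> {u<..}))" using uT by auto
    moreover have "{u} \<union> {u<..j} = {u..j}" using j(1) by auto
    ultimately have Tdec: "T = (T \<inter> {..<u}) \<union> {u..j}" unfolding j(3) by argo
    have mx: "Max T = j"
    proof (rule Max_eqI[OF finT])
      show "j \<in> T" by (subst Tdec) (use j in auto)
      fix y assume "y \<in> T"
      then have "y \<in> (T \<inter> {..<u}) \<union> {u..j}" using Tdec by blast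
      then show "y \<le> j" using j(1) by auto
    qed
    show "(case (T \<inter> {..<u}, Max T) of (T, j) \<Rightarrow> T \<union> {u..j}) = T"
      unfolding mx using Tdec by simp
    have "i = 1 \<or> i - 1 \<in> T \<inter> {..<u} \<or> i \<in> ?V'" if "i \<in> T \<inter> {..<u}" for i
    proof -
      from that have i: "i \<in> T" "i < u" by auto
      have "i \<in> ?V'" if "i \<in> ?V" using that i by force
      then show ?thesis using T(3)[OF i(1)] i(2) by auto
    qed
    then have "T \<inter> {..<u} \<in> ?I"
      using T unfolding Lambda_set_subset_iff mem_Collect_eq by (intro conjI) auto
    moreover have "j \<in> ?J" using j T(1) by auto
    ultimately show "(T \<inter> {..<u}, Max T) \<in> ?I \<times> ?J" unfolding mx by blast
    have "card T = card (T \<inter> {..<u}) + card {u..j}"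
      by (subst Tdec, subst card_Un_disjoint) (use finT in auto)
    then have "card T + card S = card (T \<inter> {..<u}) + card (S \<inter> {..<u}) + (j - u) + card (S \<inter> {u<..}) + 2"
      using cS j(1) by simp
    moreover have "(-1::rat) ^ (j + u) = (-1) ^ (j - u)"
      using j(1) by (simp add: uminus_power_if)
    ultimately show "(case (T \<inter> {..<u}, Max T) of (T, j) \<Rightarrow>
        (-1) ^ (card T + card (S \<inter> {..<u})) * (-1) ^ (j + u + card (S \<inter> {u<..}))) =
        (-1::rat) ^ (card T + card S)"
      unfolding mx by (simp add: power_add)
  next
    fix p assume "p \<in> ?I \<times> ?J"
    then obtain T j where p: "p = (T, j)" "T \<in> ?I" "j \<in> ?J" by blast
    then have T: "S \<inter> {..<u} \<subseteq> T" "T \<subseteq> {1..u - 1}" "\<And>i. i \<in> T \<Longrightarrow> i = 1 \<or> i - 1 \<in> T \<or> i \<in> ?V'"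
      unfolding Lambda_set_subset_iff by auto
    have j: "u \<le> j" "j \<le> n" "\<forall>s\<in>S \<inter> {u<..}. s \<le> j" using p by auto
    have finT: "finite T" using T(2) finite_subset by blast
    have Tu: "T \<subseteq> {..<u}" using T(2) un by force
    have m: "Max (T \<union> {u..j}) = j"
      by (rule Max_eqI) (use Tu j finT in auto)
    have "(T \<union> {u..j}) \<inter> {..<u} = T" using Tu by auto
    then show "((case p of (T, j) \<Rightarrow> T \<union> {u..j}) \<inter> {..<u}, Max (case p of (T, j) \<Rightarrow> T \<union> {u..j})) = p"
      using m p(1) by simp
    have "i = 1 \<or> i - 1 \<in> T \<union> {u..j} \<or> i \<in> ?V" if "i \<in> T \<union> {u..j}" for i
      using that
    proof
      assume "i \<in> T"
      then show ?thesis using T(3)[of i] by blast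
    next
      assume "i \<in> {u..j}"
      then show ?thesis using u(1) by (cases "i = u") auto
    qed
    moreover have "S \<subseteq> T \<union> {u..j}" by (subst Sdec) (use T j in auto)
    moreover have "T \<union> {u..j} \<subseteq> {1..n}" using T(2) j un by force
    ultimately show "(case p of (T, j) \<Rightarrow> T \<union> {u..j}) \<in> {T. S \<subseteq> T \<and> T \<subseteq> {1..n} \<and> Lambda_set T \<subseteq> ?V}"
      unfolding Lambda_set_subset_iff p(1) by auto
  qed
  also have "\<dots> = theta_coeff (u - 1) (S \<inter> {..<u}) (U - {u}) * prefix_coeff u n (S \<inter> {u<..})"
    unfolding theta_coeff_def prefix_coeff_def by (simp add: sum_product sum.cartesian_product)
  finally show ?thesis .
qed

section \<open>Chains in posets with a rank function\<close>

lemma finite_ex_max: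
  fixes f :: "'b \<Rightarrow> nat"
  assumes "finite B" "B \<noteq> {}"
  shows "\<exists>z\<in>B. \<forall>w\<in>B. f w \<le> f z"
proof -
  have "Max (f ` B) \<in> f ` B" using assms by (intro Max_in) auto
  then obtain z where z: "z \<in> B" "Max (f ` B) = f z" by auto
  have "f w \<le> f z" if "w \<in> B" for w
    using Max_ge[of "f ` B" "f w"] that assms z by simp
  then show ?thesis using z by blast
qed

lemma finite_ex_min:
  fixes f :: "'b \<Rightarrow> nat"
  assumes "B \<noteq> {}"
  shows "\<exists>z\<in>B. \<forall>w\<in>B. f z \<le> f w"
  using assms ex_has_least_nat[of "\<lambda>x. x \<in> B" _ f] by blast

text \<open>
  The last two assumptions make \<open>rho\<close> increase by exactly 1 along every covering relation. This is
  the form in which gradedness is easiest to prove, and \<open>rho\<close> is then the rank defined by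
  lengths of chains (\<open>elem_rank_eq\<close>).
\<close>

locale rank_function =
  fixes r :: "'p rel" and rho :: "'p \<Rightarrow> nat" and bt tp :: 'p
  assumes partial_order: "Partial_order r"
    and finite_Field: "finite (Field r)"
    and bt: "bt \<in> Field r" "\<And>x. x \<in> Field r \<Longrightarrow> (bt, x) \<in> r"
    and tp: "tp \<in> Field r" "\<And>x. x \<in> Field r \<Longrightarrow> (x, tp) \<in> r"
    and rho_bt: "rho bt = 0"
    and rho_less: "\<And>x y. (x, y) \<in> r \<Longrightarrow> x \<noteq> y \<Longrightarrow> rho x < rho y"
    and no_gap: "\<And>x y. (x, y) \<in> r \<Longrightarrow> rho x + 1 < rho y \<Longrightarrow>
      \<exists>z. (x, z) \<in> r \<and> (z, y) \<in> r \<and> z \<noteq> x \<and> z \<noteq> y"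
begin

lemma order_refl: "x \<in> Field r \<Longrightarrow> (x, x) \<in> r"
  using partial_order by (auto simp: partial_order_on_def preorder_on_def refl_on_def)

lemma order_trans: "(x, y) \<in> r \<Longrightarrow> (y, z) \<in> r \<Longrightarrow> (x, z) \<in> r"
  using partial_order by (auto simp: partial_order_on_def preorder_on_def trans_def)

lemma order_antisym: "(x, y) \<in> r \<Longrightarrow> (y, x) \<in> r \<Longrightarrow> x = y"
  using partial_order by (auto simp: partial_order_on_def antisym_def)

lemma in_Field: "(x, y) \<in> r \<Longrightarrow> x \<in> Field r" "(x, y) \<in> r \<Longrightarrow> y \<in> Field r"
  by (auto simp: Field_def)

lemma rho_le: "(x, y) \<in> r \<Longrightarrow> rho x \<le> rho y"
  using rho_less by (cases "x = y") (auto simp: less_imp_le)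

lemma Chains_subset_Field: "C \<in> Chains r \<Longrightarrow> C \<subseteq> Field r"
  by (auto simp: Chains_def Field_def)

lemma finite_chain: "C \<in> Chains r \<Longrightarrow> finite C"
  using Chains_subset_Field finite_Field finite_subset by blast

lemma finite_Chains: "finite (Chains r)"
  by (rule finite_subset[of _ "Pow (Field r)"]) (use Chains_subset_Field finite_Field in auto)

lemma chainD: "C \<in> Chains r \<Longrightarrow> x \<in> C \<Longrightarrow> y \<in> C \<Longrightarrow> (x, y) \<in> r \<or> (y, x) \<in> r"
  by (auto simp: Chains_def)

lemma chain_subset: "C \<in> Chains r \<Longrightarrow> D \<subseteq> C \<Longrightarrow> D \<in> Chains r"
  by (auto simp: Chains_def)

lemma chain_insert:
  assumes "C \<in> Chains r" "x \<in> Field r" "\<And>c. c \<in> C \<Longrightarrow> (x, c) \<in> r \<or> (c, x) \<in> r"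
  shows "insert x C \<in> Chains r"
  using assms order_refl by (auto simp: Chains_def)

lemma chain_le_iff:
  assumes "C \<in> Chains r" "x \<in> C" "y \<in> C"
  shows "rho x \<le> rho y \<longleftrightarrow> (x, y) \<in> r"
  using chainD[OF assms] rho_le[of x y] rho_less[of y x] by (cases "x = y") auto

lemma rho_inj_on_chain: "C \<in> Chains r \<Longrightarrow> inj_on rho C"
  by (rule inj_onI, rule order_antisym) (simp_all flip: chain_le_iff[of C])

lemma card_chain_le:
  assumes "C \<in> Chains r" "C \<subseteq> under r x"
  shows "card C \<le> rho x + 1"
proof -
  have "rho ` C \<subseteq> {..rho x}" using assms(2) rho_le by (auto simp: under_def)
  then have "card (rho ` C) \<le> rho x + 1" by (metis card_atMost card_mono finite_atMost Suc_eq_plus1)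
  then show ?thesis by (simp add: card_image rho_inj_on_chain assms(1))
qed

lemma exists_long_chain:
  assumes "x \<in> Field r"
  shows "\<exists>C\<in>Chains r. C \<subseteq> under r x \<and> card C = rho x + 1"
  using assms
proof (induction "rho x" arbitrary: x rule: less_induct)
  case (less x)
  show ?case
  proof (cases "x = bt")
    case True
    then have "{x} \<in> Chains r" "{x} \<subseteq> under r x"
      using order_refl less.prems by (auto simp: Chains_def under_def)
    then show ?thesis using True rho_bt by (intro bexI[of _ "{x}"]) auto
  next
    case False
    let ?B = "{z. (z, x) \<in> r \<and> z \<noteq> x}"
    have "finite ?B" using finite_Field in_Field by (auto intro: finite_subset)
    moreover have "bt \<in> ?B" using False bt less.prems by auto
    ultimately obtain z where z: "z \<in> ?B" "\<And>w. w \<in> ?B \<Longrightarrow> rho w \<le> rho z"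
      using finite_ex_max[of ?B rho] by blast
    have "\<not> rho z + 1 < rho x"
    proof
      assume "rho z + 1 < rho x"
      then obtain w where "(z, w) \<in> r" "(w, x) \<in> r" "w \<noteq> z" "w \<noteq> x" using no_gap z(1) by blast
      then show False using z(2)[of w] rho_less[of z w] by auto
    qed
    then have rx: "rho x = rho z + 1" using rho_less[of z x] z(1) by auto
    then obtain C where C: "C \<in> Chains r" "C \<subseteq> under r z" "card C = rho z + 1"
      using less.hyps[of z] z(1) in_Field by auto
    have Cx: "(c, x) \<in> r \<and> c \<noteq> x" if "c \<in> C" for c
      using that C(2) z(1) order_trans order_antisym unfolding under_def by blast
    have "insert x C \<in> Chains r" using C(1) less.prems Cx by (intro chain_insert) auto
    moreover have "insert x C \<subseteq> under r x" using Cx order_refl[OF less.prems] by (auto simp: under_def)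
    moreover have "card (insert x C) = rho x + 1"
      using Cx C(3) rx finite_chain[OF C(1)] by (subst card_insert_disjoint) auto
    ultimately show ?thesis by blast
  qed
qed

lemma elem_rank_eq:
  assumes "x \<in> Field r"
  shows "elem_rank r x = rho x"
proof -
  have "Max (card ` {C \<in> Chains r. C \<subseteq> under r x}) = rho x + 1"
    using exists_long_chain[OF assms] card_chain_le finite_Chains
    by (intro Max_eqI) (auto intro!: rev_image_eqI)
  then show ?thesis by (simp add: elem_rank_def)
qed

lemma poset_rank_eq: "poset_rank r = rho tp"
proof -
  have "C \<subseteq> under r tp" if "C \<in> Chains r" for C
    using that Chains_subset_Field tp(2) by (auto simp: under_def)
  then have "{C \<in> Chains r. C \<subseteq> under r tp} = Chains r" by blast
  then show ?thesis using elem_rank_eq[OF tp(1)] by (simp add: elem_rank_def poset_rank_def)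
qed

text \<open>
  A maximal chain cannot skip a rank: between its neighbouring elements \<open>a\<close> and \<open>b\<close> around a missing
  rank, \<open>no_gap\<close> supplies an element that could be added to the chain.
\<close>

lemma rho_maximal_chain:
  assumes "C \<in> maximal_chains r"
  shows "rho ` C = {..rho tp}"
proof (intro equalityI subsetI)
  have C: "C \<in> Chains r" and max: "\<And>D. D \<in> Chains r \<Longrightarrow> C \<subseteq> D \<Longrightarrow> D = C"
    using assms by (auto simp: maximal_chains_def)
  have add: "x \<in> C" if "x \<in> Field r" "\<And>c. c \<in> C \<Longrightarrow> (x, c) \<in> r \<or> (c, x) \<in> r" for x
    using max[OF chain_insert[OF C that]] by blast
  {
    fix k assume "k \<in> rho ` C"
    then show "k \<in> {..rho tp}" using Chains_subset_Field[OF C] tp(2) rho_le by blast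
  next
    fix k assume k: "k \<in> {..rho tp}"
    show "k \<in> rho ` C"
    proof (rule ccontr)
      assume nk: "k \<notin> rho ` C"
      have "bt \<in> C" using add[OF bt(1)] bt(2) Chains_subset_Field[OF C] by blast
      moreover have "tp \<in> C" using add[OF tp(1)] tp(2)[OF subsetD[OF Chains_subset_Field[OF C]]] by simp
      moreover have "rho bt \<noteq> k" "rho tp \<noteq> k" using nk calculation by blast+
      then have "rho bt < k" "k < rho tp" using k rho_bt by auto
      ultimately have ne: "{c \<in> C. rho c < k} \<noteq> {}" "{c \<in> C. k < rho c} \<noteq> {}"
        by blast+
      have "finite {c \<in> C. rho c < k}" using finite_chain[OF C] by auto
      from finite_ex_max[OF this ne(1), of rho] obtain a
        where a: "a \<in> C" "rho a < k" "\<And>c. c \<in> C \<Longrightarrow> rho c < k \<Longrightarrow> rho c \<le> rho a"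
        by blast
      from finite_ex_min[OF ne(2), of rho] obtain b
        where b: "b \<in> C" "k < rho b" "\<And>c. c \<in> C \<Longrightarrow> k < rho c \<Longrightarrow> rho b \<le> rho c"
        by blast
      have "(a, b) \<in> r" using chain_le_iff[OF C a(1) b(1)] a b by auto
      moreover have "rho a + 1 < rho b" using a b by auto
      ultimately obtain z where z: "(a, z) \<in> r" "(z, b) \<in> r" "z \<noteq> a" "z \<noteq> b"
        using no_gap by blast
      have "z \<in> C"
      proof (rule add)
        fix c assume c: "c \<in> C"
        then have "rho c < k \<or> k < rho c" using nk by (metis image_eqI linorder_neqE_nat)
        then have "(c, a) \<in> r \<or> (b, c) \<in> r"
          using a b chain_le_iff[OF C] c by blast
        then show "(z, c) \<in> r \<or> (c, z) \<in> r" using z order_trans by blast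
      qed (use z in_Field in blast)
      moreover have "rho a < rho z" "rho z < rho b" using z rho_less by auto
      moreover have "rho z < k \<or> k < rho z" using nk \<open>z \<in> C\<close> by (metis image_eqI linorder_neqE_nat)
      ultimately show False using a b by (meson leD)
    qed
  }
qed

lemma graded: "graded_poset r"
proof -
  have "card C = rho tp + 1" if "C \<in> maximal_chains r" for C
    using card_image[of rho C] rho_inj_on_chain[of C] rho_maximal_chain[OF that] that
    by (simp add: maximal_chains_def)
  then have "\<forall>C \<in> maximal_chains r. \<forall>D \<in> maximal_chains r. card C = card D" by simp
  moreover have "\<exists>!z. z \<in> Field r \<and> (\<forall>x. (x, z) \<in> r \<longrightarrow> x = z)"
  proof (rule ex1I[of _ bt], intro conjI allI impI)
    fix x assume "(x, bt) \<in> r"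
    then show "x = bt" using order_antisym bt(2) in_Field(1) by simp
  qed (use bt in auto)
  moreover have "\<exists>!z. z \<in> Field r \<and> (\<forall>x. (z, x) \<in> r \<longrightarrow> x = z)"
  proof (rule ex1I[of _ tp], intro conjI allI impI)
    fix x assume "(tp, x) \<in> r"
    then show "x = tp" using order_antisym tp(2) in_Field(2) by simp
  qed (use tp in auto)
  ultimately show ?thesis
    unfolding graded_poset_def using partial_order finite_Field by (intro conjI)
qed

lemma flag_f_eq: "flag_f r S = card {C \<in> Chains r. rho ` C = S}"
proof -
  have "elem_rank r ` C = rho ` C" if "C \<in> Chains r" for C
    using Chains_subset_Field[OF that] elem_rank_eq by (intro image_cong) auto
  then have "{C \<in> Chains r. elem_rank r ` C = S} = {C \<in> Chains r. rho ` C = S}" by auto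
  then show ?thesis by (simp add: flag_f_def)
qed

definition between :: "'p \<Rightarrow> 'p \<Rightarrow> 'p set" where
  "between x y = {z. (x, z) \<in> r \<and> (z, y) \<in> r \<and> z \<noteq> x \<and> z \<noteq> y}"

definition chains_in :: "'p \<Rightarrow> 'p \<Rightarrow> 'p set set" where
  "chains_in x y = {C \<in> Chains r. C \<subseteq> between x y}"

text \<open>
  The factor of a step \<open>x < y\<close> of a flag: the piece of \<open>theta_coeff\<close> belonging to the ranks strictly
  between \<open>x\<close> and \<open>y\<close>, summed over the chains there. For two flats of an oriented matroid it will turn
  out to be half the number of topes of the minor given by the interval from \<open>x\<close> to \<open>y\<close>.
\<close>

definition gap_weight :: "'p \<Rightarrow> 'p \<Rightarrow> rat" where
  "gap_weight x y = (\<Sum>C\<in>chains_in x y. prefix_coeff (rho x) (rho y - 1) (rho ` C))"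

text \<open>
  For \<open>y\<close> the maximum this is, up to \<open>2\<^bsup>|U| + 1\<^esup>\<close>, the coefficient of \<open>M\<^sub>U\<close> in
  \<open>vartheta (qsym_of_poset r)\<close> (\<open>sum_flag_f_theta_coeff\<close>); the other \<open>y\<close> serve the recursion on \<open>U\<close>.
\<close>

definition weight :: "'p \<Rightarrow> nat set \<Rightarrow> rat" where
  "weight y U = (\<Sum>C\<in>chains_in bt y. theta_coeff (rho y - 1) (rho ` C) U)"

lemma finite_chains_in: "finite (chains_in x y)"
  using finite_Chains by (simp add: chains_in_def)

lemma finite_between: "finite (between x y)"
  using finite_Field by (rule finite_subset[rotated]) (auto simp: between_def Field_def)

lemma rho_between: "z \<in> between x y \<Longrightarrow> rho x < rho z \<and> rho z < rho y"
  using rho_less by (auto simp: between_def)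

lemma card_rho_chain: "C \<in> Chains r \<Longrightarrow> card (rho ` C) = card C"
  using rho_inj_on_chain card_image by blast

lemma arg_min_chain:
  assumes "C \<in> Chains r" "C \<noteq> {}"
  shows "arg_min_on rho C \<in> C" "\<And>c. c \<in> C \<Longrightarrow> (arg_min_on rho C, c) \<in> r"
proof -
  show m: "arg_min_on rho C \<in> C"
    by (rule arg_min_if_finite(1)[OF finite_chain[OF assms(1)] assms(2)])
  fix c assume c: "c \<in> C"
  then have "rho (arg_min_on rho C) \<le> rho c"
    using arg_min_if_finite(2)[OF finite_chain[OF assms(1)] assms(2), of rho] by (meson not_le)
  then show "(arg_min_on rho C, c) \<in> r" using chain_le_iff[OF assms(1) m c] by simp
qed

text \<open>
  The empty chain contributes \<open>\<Sum>\<^sub>j (-1)\<^bsup>j + rho x\<^esup>\<close> over \<open>rho x \<le> j < rho y\<close>, which is 1 or 0 by parity. A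
  nonempty chain is its least element \<open>z\<close> together with a chain between \<open>z\<close> and \<open>y\<close>: the conditions on
  \<open>j\<close> are the same for both chains, and the sign changes by \<open>-(-1)\<^bsup>rho z + rho x\<^esup>\<close>.
\<close>

lemma gap_weight_rec:
  assumes "(x, y) \<in> r" "x \<noteq> y"
  shows "gap_weight x y = (if odd (rho y - rho x) then 1 else 0) -
    (\<Sum>z\<in>between x y. (-1) ^ (rho z + rho x) * gap_weight z y)"
proof -
  let ?p = "\<lambda>x C. prefix_coeff (rho x) (rho y - 1) (rho ` C)"
  have lt: "rho x < rho y" using rho_less assms by blast
  have "(\<Sum>C\<in>chains_in x y - {{}}. ?p x C)
      = (\<Sum>(z, C)\<in>Sigma (between x y) (\<lambda>z. chains_in z y). - ((-1) ^ (rho z + rho x) * ?p z C))"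
  proof (rule sum.reindex_bij_witness[of _ "\<lambda>(z, C). insert z C"
        "\<lambda>C. (arg_min_on rho C, C - {arg_min_on rho C})"])
    fix C assume C: "C \<in> chains_in x y - {{}}"
    define z where "z = arg_min_on rho C"
    have Ch: "C \<in> Chains r" "C \<subseteq> between x y" "C \<noteq> {}" using C by (auto simp: chains_in_def)
    have z: "z \<in> C" "\<And>c. c \<in> C \<Longrightarrow> (z, c) \<in> r"
      unfolding z_def using arg_min_chain[OF Ch(1,3)] by auto
    have fC: "finite C" using finite_chain Ch by blast
    have zb: "z \<in> between x y" using z(1) Ch by blast
    then have lz: "rho x < rho z" "rho z < rho y" using rho_between by auto
    show "(case (z, C - {z}) of (z, C) \<Rightarrow> insert z C) = C" using z(1) by auto
    have D: "C - {z} \<in> Chains r" using chain_subset Ch by blast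
    have "C - {z} \<subseteq> between z y" using Ch(2) z by (auto simp: between_def)
    then show "(z, C - {z}) \<in> Sigma (between x y) (\<lambda>z. chains_in z y)"
      using zb D by (auto simp: chains_in_def)
    have "{j. rho x \<le> j \<and> j \<le> rho y - 1 \<and> (\<forall>s\<in>rho ` C. s \<le> j)} =
        {j. rho z \<le> j \<and> j \<le> rho y - 1 \<and> (\<forall>s\<in>rho ` (C - {z}). s \<le> j)}"
      using z(1) lz by auto
    moreover have "card (rho ` C) = Suc (card (rho ` (C - {z})))"
      unfolding card_rho_chain[OF Ch(1)] card_rho_chain[OF D] using card.remove[OF fC z(1)] by simp
    ultimately have "?p x C = (\<Sum>j | rho z \<le> j \<and> j \<le> rho y - 1 \<and> (\<forall>s\<in>rho ` (C - {z}). s \<le> j).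
        - ((-1) ^ (rho z + rho x) * (-1) ^ (j + rho z + card (rho ` (C - {z})))))"
      unfolding prefix_coeff_def by (intro sum.cong) (simp_all add: power_add)
    then show "(case (z, C - {z}) of (z, C) \<Rightarrow> - ((-1) ^ (rho z + rho x) * ?p z C)) = ?p x C"
      by (simp add: prefix_coeff_def sum_distrib_left sum_negf)
  next
    fix p assume "p \<in> Sigma (between x y) (\<lambda>z. chains_in z y)"
    then obtain z C where p: "p = (z, C)" "z \<in> between x y" "C \<in> Chains r" "C \<subseteq> between z y"
      by (auto simp: chains_in_def)
    have zc: "(z, c) \<in> r" "c \<noteq> z" if "c \<in> C" for c using that p(4) by (auto simp: between_def)
    have ch: "insert z C \<in> Chains r"
      using p zc in_Field unfolding between_def by (intro chain_insert) blast+
    have "insert z C \<subseteq> between x y"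
      using p order_trans order_antisym unfolding between_def by blast
    then show "(case p of (z, C) \<Rightarrow> insert z C) \<in> chains_in x y - {{}}"
      using ch p(1) by (auto simp: chains_in_def)
    have "(arg_min_on rho (insert z C), z) \<in> r" "arg_min_on rho (insert z C) \<in> insert z C"
      using arg_min_chain[OF ch] by auto
    then have m: "arg_min_on rho (insert z C) = z" using zc order_antisym by blast
    have "C - {z} = C" using zc by auto
    then show "(arg_min_on rho (case p of (z, C) \<Rightarrow> insert z C),
        (case p of (z, C) \<Rightarrow> insert z C) - {arg_min_on rho (case p of (z, C) \<Rightarrow> insert z C)}) = p"
      using p(1) m by simp
  qed
  also have "\<dots> = - (\<Sum>z\<in>between x y. (-1) ^ (rho z + rho x) * gap_weight z y)"
    unfolding gap_weight_def
    by (subst sum.Sigma[symmetric])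
      (simp_all add: finite_between finite_chains_in sum_negf sum_distrib_left)
  finally have ne: "(\<Sum>C\<in>chains_in x y - {{}}. ?p x C) = \<dots>" .
  have "{} \<in> chains_in x y" by (auto simp: chains_in_def Chains_def)
  then have "gap_weight x y = ?p x {} + (\<Sum>C\<in>chains_in x y - {{}}. ?p x C)"
    unfolding gap_weight_def by (rule sum.remove[OF finite_chains_in])
  moreover have "?p x {} = (if odd (rho y - rho x) then 1 else 0)"
    using prefix_coeff_empty[of "rho x" "rho y - 1"] lt by auto
  ultimately show ?thesis unfolding ne by simp
qed

lemma rho_chains_in:
  assumes "C \<in> chains_in x y"
  shows "rho ` C \<subseteq> {rho x<..rho y - 1}"
  using assms rho_between by (fastforce simp: chains_in_def)

lemma weight_empty: "weight y {} = gap_weight bt y"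
  unfolding weight_def gap_weight_def rho_bt
  by (intro sum.cong refl theta_coeff_empty) (use rho_chains_in[of _ bt y] rho_bt in fastforce)

text \<open>
  Chains without an element of rank \<open>u = Max U\<close> contribute nothing (\<open>theta_coeff_eq_0\<close>); any other
  chain consists of its element \<open>x\<close> of rank \<open>u\<close>, a chain below \<open>x\<close> and a chain between \<open>x\<close> and \<open>y\<close>, and
  \<open>theta_coeff\<close> factors accordingly (\<open>theta_coeff_split\<close>).
\<close>

lemma weight_rec:
  assumes U: "U \<subseteq> {1..rho y - 1}" and u: "u \<in> U" "\<And>v. v \<in> U \<Longrightarrow> v \<le> u" and y: "y \<in> Field r"
  shows "weight y U = (\<Sum>x | (x, y) \<in> r \<and> rho x = u. weight x (U - {u}) * gap_weight x y)"
proof -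
  let ?t = "\<lambda>C. theta_coeff (rho y - 1) (rho ` C) U"
  let ?X = "{x. (x, y) \<in> r \<and> rho x = u}"
  let ?D = "{C \<in> chains_in bt y. u \<in> rho ` C}"
  have un: "1 \<le> u" "u < rho y" using subsetD[OF U u(1)] by auto
  have X: "x \<in> between bt y" if "x \<in> ?X" for x
    using that un rho_bt in_Field bt by (auto simp: between_def)
  have "finite ?X" using finite_Field in_Field by (auto intro: finite_subset)
  have sub: "rho ` C \<subseteq> {1..rho y - 1}" if "C \<in> chains_in bt y" for C
    using rho_chains_in[OF that] rho_bt by force
  have "weight y U = (\<Sum>C\<in>?D. ?t C)"
    unfolding weight_def
  proof (rule sum.mono_neutral_right[OF finite_chains_in])
    show "\<forall>C\<in>chains_in bt y - ?D. ?t C = 0"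
      using theta_coeff_eq_0[OF u(1) subsetD[OF U u(1)]] by blast
  qed auto
  also have "\<dots> = (\<Sum>(x, C1, C2)\<in>Sigma ?X (\<lambda>x. chains_in bt x \<times> chains_in x y).
      theta_coeff (u - 1) (rho ` C1) (U - {u}) * prefix_coeff u (rho y - 1) (rho ` C2))"
  proof (rule sum.reindex_bij_witness[of _ "\<lambda>(x, C1, C2). C1 \<union> {x} \<union> C2"
        "\<lambda>C. (THE x. x \<in> C \<and> rho x = u, {c \<in> C. rho c < u}, {c \<in> C. u < rho c})"])
    fix C assume "C \<in> ?D"
    then have C: "C \<in> chains_in bt y" "C \<in> Chains r" "C \<subseteq> between bt y" "u \<in> rho ` C"
      by (auto simp: chains_in_def)
    then obtain x where x: "x \<in> C" "rho x = u" by blast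
    have the: "(THE x. x \<in> C \<and> rho x = u) = x"
      using x rho_inj_on_chain[OF C(2)] by (auto simp: inj_on_def)
    have xeq: "c = x" if "c \<in> C" "rho c = u" for c
      using that x rho_inj_on_chain[OF C(2)] by (auto simp: inj_on_def)
    have "c \<in> {c \<in> C. rho c < u} \<union> {x} \<union> {c \<in> C. u < rho c} \<longleftrightarrow> c \<in> C" for c
      using x(1) xeq[of c] less_linear[of "rho c" u] by blast
    then show "(case (THE x. x \<in> C \<and> rho x = u, {c \<in> C. rho c < u}, {c \<in> C. u < rho c}) of
        (x, C1, C2) \<Rightarrow> C1 \<union> {x} \<union> C2) = C"
      unfolding the prod.case by (rule set_eqI)
    have below: "(c, x) \<in> r" "c \<noteq> x" if "c \<in> C" "rho c < u" for c
      using chain_le_iff[OF C(2) that(1) x(1)] that(2) x(2) by auto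
    have above: "(x, c) \<in> r" "c \<noteq> x" if "c \<in> C" "u < rho c" for c
      using chain_le_iff[OF C(2) x(1) that(1)] that(2) x(2) by auto
    have "{c \<in> C. rho c < u} \<subseteq> between bt x" "{c \<in> C. u < rho c} \<subseteq> between x y"
      using C(3) below above unfolding between_def by blast+
    then have "{c \<in> C. rho c < u} \<in> chains_in bt x" "{c \<in> C. u < rho c} \<in> chains_in x y"
      using chain_subset[OF C(2)] by (auto simp: chains_in_def)
    moreover have "x \<in> ?X" using x(2) subsetD[OF C(3) x(1)] by (auto simp: between_def)
    ultimately show "(THE x. x \<in> C \<and> rho x = u, {c \<in> C. rho c < u}, {c \<in> C. u < rho c})
        \<in> Sigma ?X (\<lambda>x. chains_in bt x \<times> chains_in x y)"
      unfolding the by blast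
    have "rho ` C \<inter> {..<u} = rho ` {c \<in> C. rho c < u}" "rho ` C \<inter> {u<..} = rho ` {c \<in> C. u < rho c}"
      by auto
    then show "(case (THE x. x \<in> C \<and> rho x = u, {c \<in> C. rho c < u}, {c \<in> C. u < rho c}) of
        (x, C1, C2) \<Rightarrow> theta_coeff (u - 1) (rho ` C1) (U - {u}) *
          prefix_coeff u (rho y - 1) (rho ` C2)) = ?t C"
      using theta_coeff_split[OF U u sub[OF C(1)] C(4)] by simp
  next
    fix p assume "p \<in> Sigma ?X (\<lambda>x. chains_in bt x \<times> chains_in x y)"
    then obtain x C1 C2 where p: "p = (x, C1, C2)" "(x, y) \<in> r" "rho x = u"
      "C1 \<in> Chains r" "C1 \<subseteq> between bt x" "C2 \<in> Chains r" "C2 \<subseteq> between x y"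
      by (auto simp: chains_in_def)
    have c1: "(c, x) \<in> r" "rho c < u" if "c \<in> C1" for c
      using that p rho_between by (auto simp: between_def)
    have c2: "(x, c) \<in> r" "u < rho c" if "c \<in> C2" for c
      using that p rho_between by (auto simp: between_def)
    have xx: "(x, x) \<in> r" using p(2) in_Field order_refl by blast
    have ch: "C1 \<union> {x} \<union> C2 \<in> Chains r"
      unfolding Chains_def
    proof (intro CollectI ballI)
      fix a b assume "a \<in> C1 \<union> {x} \<union> C2" "b \<in> C1 \<union> {x} \<union> C2"
      then show "(a, b) \<in> r \<or> (b, a) \<in> r"
        using c1(1) c2(1) xx chainD[OF p(4)] chainD[OF p(6)] order_trans by (elim UnE) blast+
    qed
    have "C1 \<union> {x} \<union> C2 \<subseteq> between bt y"
    proof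
      fix c assume "c \<in> C1 \<union> {x} \<union> C2"
      moreover have "x \<in> between bt y" using p X by blast
      ultimately show "c \<in> between bt y"
        using p(5,7) order_trans order_antisym unfolding between_def by blast
    qed
    then show "(case p of (x, C1, C2) \<Rightarrow> C1 \<union> {x} \<union> C2) \<in> ?D"
      using ch p by (auto simp: chains_in_def)
    have the: "(THE z. z \<in> C1 \<union> {x} \<union> C2 \<and> rho z = u) = x"
      using p(3) by (intro the_equality) (auto dest!: c1(2) c2(2))
    have "c \<in> C1 \<union> {x} \<union> C2 \<and> rho c < u \<longleftrightarrow> c \<in> C1" "c \<in> C1 \<union> {x} \<union> C2 \<and> u < rho c \<longleftrightarrow> c \<in> C2"
      for c
      using p(3) c1(2)[of c] c2(2)[of c] by auto
    then have "{c \<in> C1 \<union> {x} \<union> C2. rho c < u} = C1" "{c \<in> C1 \<union> {x} \<union> C2. u < rho c} = C2"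
      by blast+
    then show "(THE z. z \<in> (case p of (x, C1, C2) \<Rightarrow> C1 \<union> {x} \<union> C2) \<and> rho z = u,
        {c \<in> (case p of (x, C1, C2) \<Rightarrow> C1 \<union> {x} \<union> C2). rho c < u},
        {c \<in> (case p of (x, C1, C2) \<Rightarrow> C1 \<union> {x} \<union> C2). u < rho c}) = p"
      using the p(1) by simp
  qed
  also have "\<dots> = (\<Sum>x\<in>?X. \<Sum>(C1, C2)\<in>chains_in bt x \<times> chains_in x y.
      theta_coeff (u - 1) (rho ` C1) (U - {u}) * prefix_coeff u (rho y - 1) (rho ` C2))"
    by (subst sum.Sigma) (use \<open>finite ?X\<close> finite_chains_in in auto)
  also have "\<dots> = (\<Sum>x\<in>?X. weight x (U - {u}) * gap_weight x y)"
    by (intro sum.cong refl)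
      (auto simp: weight_def gap_weight_def sum_product sum.cartesian_product)
  finally show ?thesis .
qed

definition flags :: "'p \<Rightarrow> nat set \<Rightarrow> nat" where
  "flags y U = card {C \<in> chains_in bt y. rho ` C = U}"

lemma flags_empty: "flags y {} = 1"
proof -
  have "{C \<in> chains_in bt y. rho ` C = {}} = {{}}" by (auto simp: chains_in_def Chains_def)
  then show ?thesis by (simp add: flags_def)
qed

text \<open>
  The counterpart of \<open>weight_rec\<close> for plain counting: split off the top element of the flag.
\<close>

lemma flags_rec:
  assumes U: "U \<subseteq> {1..rho y - 1}" and u: "u \<in> U" "\<And>v. v \<in> U \<Longrightarrow> v \<le> u"
  shows "flags y U = (\<Sum>x | (x, y) \<in> r \<and> rho x = u. flags x (U - {u}))"
proof -
  let ?X = "{x. (x, y) \<in> r \<and> rho x = u}"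
  let ?D = "\<lambda>x U. {C \<in> chains_in bt x. rho ` C = U}"
  have un: "1 \<le> u" "u < rho y" using subsetD[OF U u(1)] by auto
  have finX: "finite ?X" using finite_Field in_Field by (auto intro: finite_subset)
  have "bij_betw (\<lambda>(x, C). insert x C) (Sigma ?X (\<lambda>x. ?D x (U - {u}))) (?D y U)"
  proof (rule bij_betw_byWitness[where f' = "\<lambda>C. (THE x. x \<in> C \<and> rho x = u, {c \<in> C. rho c < u})"])
    have fwd: "insert x C \<in> ?D y U \<and> (THE z. z \<in> insert x C \<and> rho z = u) = x \<and> {c \<in> insert x C. rho c < u} = C"
      if x: "(x, y) \<in> r" "rho x = u" and C: "C \<in> chains_in bt x" "rho ` C = U - {u}" for x C
    proof -
      have xF: "x \<in> Field r" using x in_Field by blast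
      have c: "(c, x) \<in> r" "rho c < u" if "c \<in> C" for c
        using that C(1) rho_between x(2) by (auto simp: chains_in_def between_def)
      have ch: "insert x C \<in> Chains r"
        using C(1) c(1) xF by (intro chain_insert) (auto simp: chains_in_def)
      have "x \<noteq> bt" "x \<noteq> y" using un x rho_bt by auto
      then have "x \<in> between bt y" using xF bt x by (auto simp: between_def)
      moreover have "c \<in> between bt y" if cC: "c \<in> C" for c
      proof -
        have "c \<in> between bt x" using C(1) cC by (auto simp: chains_in_def)
        moreover have "c \<noteq> y" using c(2)[OF cC] un by auto
        ultimately show ?thesis using order_trans[OF c(1)[OF cC] x(1)] by (auto simp: between_def)
      qed
      ultimately have "insert x C \<in> ?D y U"
        using ch C(2) u(1) x(2) by (auto simp: chains_in_def)
      moreover have "(THE z. z \<in> insert x C \<and> rho z = u) = x"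
        using x(2) by (intro the_equality) (auto dest!: c(2))
      moreover have "z \<in> insert x C \<and> rho z < u \<longleftrightarrow> z \<in> C" for z
        using c(2)[of z] x(2) by auto
      then have "{z \<in> insert x C. rho z < u} = C" by blast
      ultimately show ?thesis by blast
    qed
    show "\<forall>p\<in>Sigma ?X (\<lambda>x. ?D x (U - {u})).
        (THE x. x \<in> (case p of (x, C) \<Rightarrow> insert x C) \<and> rho x = u,
          {c \<in> (case p of (x, C) \<Rightarrow> insert x C). rho c < u}) = p"
      using fwd by auto
    show "(\<lambda>(x, C). insert x C) ` Sigma ?X (\<lambda>x. ?D x (U - {u})) \<subseteq> ?D y U"
    proof (rule image_subsetI)
      fix p assume "p \<in> Sigma ?X (\<lambda>x. ?D x (U - {u}))"
      then obtain x C where p: "p = (x, C)" "(x, y) \<in> r" "rho x = u" "C \<in> chains_in bt x" "rho ` C = U - {u}"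
        by blast
      then show "(case p of (x, C) \<Rightarrow> insert x C) \<in> ?D y U" using fwd[OF p(2-5)] by simp
    qed
    have bwd: "\<exists>x. (THE x. x \<in> C \<and> rho x = u) = x \<and> x \<in> ?X \<and> {c \<in> C. rho c < u} \<in> ?D x (U - {u}) \<and>
        insert x {c \<in> C. rho c < u} = C" if C: "C \<in> ?D y U" for C
    proof -
      have ch: "C \<in> Chains r" "C \<subseteq> between bt y" "rho ` C = U" using C by (auto simp: chains_in_def)
      then have "u \<in> rho ` C" using u(1) by simp
      then obtain x where x: "x \<in> C" "rho x = u" by blast
      have xeq: "c = x" if "c \<in> C" "rho c = u" for c
        using that x rho_inj_on_chain[OF ch(1)] by (auto simp: inj_on_def)
      have "(THE x. x \<in> C \<and> rho x = u) = x"
        using x xeq by (intro the_equality) blast+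
      moreover have "x \<in> ?X" using x(2) subsetD[OF ch(2) x(1)] by (auto simp: between_def)
      moreover have below: "(c, x) \<in> r \<and> c \<noteq> x" if "c \<in> C" "rho c < u" for c
        using chain_le_iff[OF ch(1) that(1) x(1)] that(2) x(2) by auto
      have "{c \<in> C. rho c < u} \<in> chains_in bt x"
        using chain_subset[OF ch(1), of "{c \<in> C. rho c < u}"] ch(2) below
        unfolding chains_in_def between_def by blast
      moreover have le: "rho c \<le> u" if "c \<in> C" for c using u(2) ch(3) that by blast
      have "rho ` {c \<in> C. rho c < u} = U - {u}"
        unfolding ch(3)[symmetric] using le by (auto simp: order_le_less)
      moreover have "c \<in> insert x {c \<in> C. rho c < u} \<longleftrightarrow> c \<in> C" for c
        using le[of c] xeq[of c] x(1) by (auto simp: order_le_less)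
      then have "insert x {c \<in> C. rho c < u} = C" by (rule set_eqI)
      ultimately show ?thesis by (intro exI[of _ x]) simp
    qed
    show "\<forall>C\<in>?D y U. (case (THE x. x \<in> C \<and> rho x = u, {c \<in> C. rho c < u}) of (x, C) \<Rightarrow> insert x C) = C"
      using bwd by fastforce
    show "(\<lambda>C. (THE x. x \<in> C \<and> rho x = u, {c \<in> C. rho c < u})) ` ?D y U \<subseteq> Sigma ?X (\<lambda>x. ?D x (U - {u}))"
      using bwd by fastforce
  qed
  then have "flags y U = card (Sigma ?X (\<lambda>x. ?D x (U - {u})))"
    unfolding flags_def by (simp add: bij_betw_same_card)
  also have "\<dots> = (\<Sum>x\<in>?X. flags x (U - {u}))"
    unfolding flags_def using finite_chains_in finX by (intro card_SigmaI) auto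
  finally show ?thesis .
qed

lemma chains_in_bt_tp:
  assumes "rho tp = n + 1"
  shows "chains_in bt tp = {C \<in> Chains r. rho ` C \<subseteq> {1..n}}"
proof (intro equalityI subsetI)
  fix C assume "C \<in> chains_in bt tp"
  then show "C \<in> {C \<in> Chains r. rho ` C \<subseteq> {1..n}}"
    using rho_chains_in[of C bt tp] assms rho_bt by (auto simp: chains_in_def)
next
  fix C assume "C \<in> {C \<in> Chains r. rho ` C \<subseteq> {1..n}}"
  then have C: "C \<in> Chains r" "\<And>c. c \<in> C \<Longrightarrow> rho c \<in> {1..n}" by auto
  then show "C \<in> chains_in bt tp"
    using Chains_subset_Field[OF C(1)] bt tp assms rho_bt
    by (fastforce simp: chains_in_def between_def)
qed

lemma flag_f_eq_flags:
  assumes "rho tp = n + 1" "U \<subseteq> {1..n}"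
  shows "flag_f r U = flags tp U"
proof -
  have "{C \<in> Chains r. rho ` C = U} = {C \<in> chains_in bt tp. rho ` C = U}"
    using chains_in_bt_tp[OF assms(1)] assms(2) by blast
  then show ?thesis by (simp add: flag_f_eq flags_def)
qed

lemma sum_flag_f_theta_coeff:
  assumes "rho tp = n + 1"
  shows "(\<Sum>S | S \<subseteq> {1..n}. of_nat (flag_f r S) * theta_coeff n S U) = weight tp U"
proof -
  note eq = chains_in_bt_tp[OF assms]
  have "weight tp U = (\<Sum>S | S \<subseteq> {1..n}. \<Sum>C | C \<in> chains_in bt tp \<and> rho ` C = S.
      theta_coeff n (rho ` C) U)"
    unfolding weight_def assms
    by (subst sum.group[symmetric, of _ "{S. S \<subseteq> {1..n}}" "image rho"])
      (use finite_chains_in[of bt tp] eq in auto)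
  also have "\<dots> = (\<Sum>S | S \<subseteq> {1..n}. of_nat (flag_f r S) * theta_coeff n S U)"
  proof (rule sum.cong[OF refl])
    fix S assume "S \<in> {S. S \<subseteq> {1..n}}"
    then have "{C \<in> chains_in bt tp. rho ` C = S} = {C \<in> Chains r. rho ` C = S}"
      unfolding eq by auto
    then show "(\<Sum>C | C \<in> chains_in bt tp \<and> rho ` C = S. theta_coeff n (rho ` C) U) =
        of_nat (flag_f r S) * theta_coeff n S U"
      by (simp add: flag_f_eq)
  qed
  finally show ?thesis by simp
qed

end

section \<open>The rank function of a matroid given by its closure operator\<close>

text \<open>
  The flats of an oriented matroid come as an intersection-closed family of sets, hence as a closure
  operator; the rank function enters only through bases. The following develops just enough
  matroid theory to connect the two.
\<close>

locale matroid_closure =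
  fixes E :: "'e set" and cl :: "'e set \<Rightarrow> 'e set"
  assumes finite_E: "finite E"
    and cl_subset: "\<And>A. A \<subseteq> E \<Longrightarrow> cl A \<subseteq> E"
    and cl_extensive: "\<And>A. A \<subseteq> E \<Longrightarrow> A \<subseteq> cl A"
    and cl_least: "\<And>A B. A \<subseteq> cl B \<Longrightarrow> B \<subseteq> E \<Longrightarrow> cl A \<subseteq> cl B"
    and exchange: "\<And>A e f. A \<subseteq> E \<Longrightarrow> e \<in> E \<Longrightarrow> f \<in> cl (insert e A) \<Longrightarrow> f \<notin> cl A \<Longrightarrow>
      e \<in> cl (insert f A)"
begin

definition indep :: "'e set \<Rightarrow> bool" where
  "indep I \<longleftrightarrow> I \<subseteq> E \<and> (\<forall>i\<in>I. i \<notin> cl (I - {i}))"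

definition basis_of :: "'e set \<Rightarrow> 'e set \<Rightarrow> bool" where
  "basis_of A I \<longleftrightarrow> indep I \<and> I \<subseteq> A \<and> A \<subseteq> cl I"

definition bases :: "'e set set" where
  "bases = {B. indep B \<and> cl B = E}"

definition rank :: "'e set \<Rightarrow> nat" where
  "rank A = Max ((\<lambda>B. card (A \<inter> B)) ` bases)"

lemma cl_mono: "A \<subseteq> B \<Longrightarrow> B \<subseteq> E \<Longrightarrow> cl A \<subseteq> cl B"
  using cl_least[of A B] cl_extensive[of B] by blast

lemma cl_cl: "A \<subseteq> E \<Longrightarrow> cl (cl A) = cl A"
  using cl_least[of "cl A" A] cl_extensive[of "cl A"] cl_subset[of A] by blast

lemma finite_subset_E: "A \<subseteq> E \<Longrightarrow> finite A"
  using finite_E finite_subset by blast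

lemma indep_subset:
  assumes "indep I" "J \<subseteq> I"
  shows "indep J"
proof -
  have "I \<subseteq> E" using assms by (simp add: indep_def)
  then have "cl (J - {i}) \<subseteq> cl (I - {i})" for i
    using assms(2) by (intro cl_mono) auto
  then show ?thesis using assms unfolding indep_def by blast
qed

lemma indep_insert:
  assumes "indep I" "e \<in> E" "e \<notin> cl I"
  shows "indep (insert e I)"
proof -
  have I: "I \<subseteq> E" "\<And>i. i \<in> I \<Longrightarrow> i \<notin> cl (I - {i})" using assms(1) by (auto simp: indep_def)
  have eI: "e \<notin> I" using cl_extensive[OF I(1)] assms(3) by blast
  have "i \<notin> cl (insert e I - {i})" if "i \<in> I" for i
  proof
    assume "i \<in> cl (insert e I - {i})"
    moreover have "insert e I - {i} = insert e (I - {i})" using eI that by blast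
    ultimately have "e \<in> cl (insert i (I - {i}))"
      using exchange[of "I - {i}" e i] I that assms(2) by auto
    then show False using that assms(3) by (simp add: insert_absorb)
  qed
  then show ?thesis using I eI assms(2,3) by (auto simp: indep_def)
qed

text \<open>
  Steinitz: an element \<open>i \<in> I - S\<close> can be exchanged for an element of \<open>S\<close>, because \<open>I - {i}\<close> cannot span \<open>S\<close>
  when it does not span \<open>i\<close>. This brings \<open>I\<close> closer to \<open>S\<close> without changing its size.
\<close>

lemma card_indep_le:
  assumes "indep I" "I \<subseteq> cl S" "S \<subseteq> E"
  shows "card I \<le> card S"
  using assms
proof (induction "card (I - S)" arbitrary: I rule: less_induct)
  case (less I)
  have I: "I \<subseteq> E" using less.prems by (simp add: indep_def)
  show ?case
  proof (cases "I \<subseteq> S")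
    case True
    then show ?thesis using finite_subset_E[OF assms(3)] card_mono by blast
  next
    case False
    then obtain i where i: "i \<in> I" "i \<notin> S" by blast
    have ni: "i \<notin> cl (I - {i})" using less.prems i by (simp add: indep_def)
    have "\<not> S \<subseteq> cl (I - {i})"
    proof
      assume "S \<subseteq> cl (I - {i})"
      then have "cl S \<subseteq> cl (I - {i})" using I by (intro cl_least) auto
      then show False using ni i less.prems(2) by blast
    qed
    then obtain s where s: "s \<in> S" "s \<notin> cl (I - {i})" by blast
    have sI: "s \<notin> I" using s i cl_extensive[of "I - {i}"] I by blast
    let ?J = "insert s (I - {i})"
    have "indep ?J" using indep_insert[of "I - {i}" s] indep_subset[OF less.prems(1)] s assms(3) by blast
    moreover have "?J \<subseteq> cl S" using less.prems(2) s(1) cl_extensive[OF assms(3)] by blast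
    moreover have "card (?J - S) < card (I - S)"
      using i s(1) finite_subset_E[OF I] by (intro psubset_card_mono) auto
    ultimately have "card ?J \<le> card S" using less.hyps assms(3) by blast
    moreover have "card ?J = card I"
      using sI card_Suc_Diff1[OF finite_subset_E[OF I] i(1)] finite_subset_E[OF I] by simp
    ultimately show ?thesis by simp
  qed
qed

lemma extend_to_basis:
  assumes "indep J" "J \<subseteq> A" "A \<subseteq> E"
  shows "\<exists>I. J \<subseteq> I \<and> basis_of A I"
proof -
  let ?F = "{I. indep I \<and> J \<subseteq> I \<and> I \<subseteq> A}"
  have fin: "finite ?F"
    using finite_subset_E[OF assms(3)] by (auto intro: finite_subset[of _ "Pow A"])
  have "J \<in> ?F" using assms by blast
  then obtain I where I: "I \<in> ?F" "\<And>K. K \<in> ?F \<Longrightarrow> card K \<le> card I"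
    using finite_ex_max[OF fin, of card] by blast
  have "A \<subseteq> cl I"
  proof (rule ccontr)
    assume "\<not> A \<subseteq> cl I"
    then obtain e where e: "e \<in> A" "e \<notin> cl I" by blast
    have "e \<notin> I" using e cl_extensive[of I] I(1) assms(3) by blast
    moreover have "insert e I \<in> ?F" using indep_insert[of I e] e I(1) assms(3) by blast
    moreover have "finite I" using I(1) assms(3) finite_subset_E[of I] by blast
    ultimately show False using I(2)[of "insert e I"] by simp
  qed
  then show ?thesis using I(1) by (auto simp: basis_of_def)
qed

lemma indep_empty: "indep {}"
  by (simp add: indep_def)

lemma basis_of_exists: "A \<subseteq> E \<Longrightarrow> \<exists>I. basis_of A I"
  using extend_to_basis[OF indep_empty] by blast

lemma cl_basis_of: "basis_of A I \<Longrightarrow> A \<subseteq> E \<Longrightarrow> cl I = cl A"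
  unfolding basis_of_def using cl_least[of A I] cl_mono[of I A] by blast

text \<open>
  A basis \<open>I\<close> of \<open>A\<close> extends to a basis of the matroid, which meets \<open>A\<close> in at least \<open>card I\<close> elements; no
  other basis meets \<open>A\<close> in more, by \<open>card_indep_le\<close>.
\<close>

lemma rank_eq_card_basis:
  assumes "A \<subseteq> E" "basis_of A I"
  shows "rank A = card I"
proof -
  have I: "indep I" "I \<subseteq> A" "A \<subseteq> cl I" "I \<subseteq> E"
    using assms by (auto simp: basis_of_def)
  have le: "card (A \<inter> B) \<le> card I" if "B \<in> bases" for B
    using that card_indep_le[of "A \<inter> B" I] indep_subset[of B "A \<inter> B"] I by (auto simp: bases_def)
  obtain B where B: "I \<subseteq> B" "basis_of E B" using extend_to_basis[OF I(1,4)] by blast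
  then have "indep B" "cl B = E" using cl_subset[of B] unfolding basis_of_def by auto
  then have Bb: "B \<in> bases" unfolding bases_def by blast
  have "card I \<le> card (A \<inter> B)"
    using I(2) B(1) finite_subset_E[OF assms(1)] by (intro card_mono) auto
  then have "card I = card (A \<inter> B)" using le[OF Bb] by simp
  then show ?thesis
    unfolding rank_def using le Bb finite_E
    by (intro Max_eqI finite_imageI finite_subset[of bases "Pow E"])
      (auto simp: bases_def indep_def)
qed

lemma rank_cl:
  assumes "A \<subseteq> E"
  shows "rank (cl A) = rank A"
proof -
  obtain I where I: "basis_of A I" using basis_of_exists[OF assms] by blast
  then have "basis_of (cl A) I"
    using cl_basis_of[OF I assms] cl_extensive[OF assms] by (auto simp: basis_of_def)
  then show ?thesis
    using I rank_eq_card_basis assms cl_subset by simp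
qed

lemma rank_mono:
  assumes "A \<subseteq> B" "B \<subseteq> E"
  shows "rank A \<le> rank B"
proof -
  obtain I where I: "basis_of A I" using basis_of_exists[of A] assms by blast
  then obtain K where K: "I \<subseteq> K" "basis_of B K"
    using extend_to_basis[of I B] assms by (auto simp: basis_of_def)
  have "finite K" using K(2) assms(2) finite_subset_E by (auto simp: basis_of_def)
  then show ?thesis
    using I K rank_eq_card_basis[of A I] rank_eq_card_basis[of B K] assms card_mono[of K I] by auto
qed

lemma rank_insert:
  assumes "A \<subseteq> E" "e \<in> E"
  shows "rank (insert e A) = (if e \<in> cl A then rank A else rank A + 1)"
proof (cases "e \<in> cl A")
  case True
  then have "cl (insert e A) = cl A"
    using cl_least[of "insert e A" A] cl_mono[of A "insert e A"] cl_extensive[of A] assms by blast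
  then show ?thesis using True rank_cl[of A] rank_cl[of "insert e A"] assms by simp
next
  case False
  obtain I where I: "basis_of A I" using basis_of_exists[OF assms(1)] by blast
  then have IE: "I \<subseteq> E" "indep I" "I \<subseteq> A" using assms by (auto simp: basis_of_def)
  have e: "e \<notin> cl I" using False cl_basis_of[OF I assms(1)] by simp
  have "A \<subseteq> cl (insert e I)"
    using I cl_mono[of I "insert e I"] IE assms(2) unfolding basis_of_def by blast
  moreover have "e \<in> cl (insert e I)" using cl_extensive[of "insert e I"] IE assms(2) by blast
  ultimately have "basis_of (insert e A) (insert e I)"
    using indep_insert[OF IE(2) assms(2) e] IE(3) by (auto simp: basis_of_def)
  then have "rank (insert e A) = card (insert e I)"
    using assms by (intro rank_eq_card_basis) auto
  moreover have "e \<notin> I" using e cl_extensive[OF IE(1)] by blast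
  ultimately show ?thesis
    using False rank_eq_card_basis[OF assms(1) I] finite_subset_E[OF IE(1)] by simp
qed

lemma rank_cl_insert:
  assumes "A \<subseteq> E" "e \<in> E" "e \<notin> cl A"
  shows "rank (cl (insert e A)) = rank A + 1"
  using rank_cl[of "insert e A"] rank_insert[of A e] assms by simp

lemma rank_cl_empty: "rank (cl {}) = 0"
  using rank_cl[of "{}"] rank_eq_card_basis[of "{}" "{}"] indep_empty by (simp add: basis_of_def)

lemma rank_closed_less:
  assumes "A \<subset> B" "B \<subseteq> E" "cl A = A"
  shows "rank A < rank B"
proof -
  obtain e where e: "e \<in> B" "e \<notin> A" using assms(1) by blast
  then have "rank (insert e A) = rank A + 1" using rank_insert[of A e] assms by auto
  moreover have "rank (insert e A) \<le> rank B" using e assms by (intro rank_mono) auto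
  ultimately show ?thesis by simp
qed

text \<open>
  The closed sets have a rank function in the above sense: adding a single element to a closed set
  and closing up raises the rank by one only.
\<close>

lemma closed_no_gap:
  assumes "A \<subseteq> B" "B \<subseteq> E" "cl A = A" "cl B = B" "rank A + 1 < rank B"
  shows "\<exists>C. cl C = C \<and> A \<subset> C \<and> C \<subset> B"
proof -
  have "A \<noteq> B" using assms(5) by auto
  then obtain e where e: "e \<in> B" "e \<notin> A" using assms(1) by blast
  have AE: "insert e A \<subseteq> E" using e assms by blast
  have "rank (cl (insert e A)) = rank A + 1" using rank_cl_insert[of A e] e assms by blast
  then have "cl (insert e A) \<noteq> B" using assms(5) by auto
  moreover have "cl (insert e A) \<subseteq> B" using cl_least[of "insert e A" B] e assms by blast
  moreover have "A \<subset> cl (insert e A)" using cl_extensive[OF AE] e by blast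
  ultimately show ?thesis using cl_cl[OF AE] by blast
qed

lemma closed_iff_rank_less:
  assumes "A \<subseteq> E"
  shows "(\<forall>e\<in>E - A. rank A < rank (insert e A)) \<longleftrightarrow> cl A = A"
proof
  assume less: "\<forall>e\<in>E - A. rank A < rank (insert e A)"
  have "cl A \<subseteq> A"
  proof
    fix e assume e: "e \<in> cl A"
    then have eE: "e \<in> E" using cl_subset[OF assms] by blast
    have "rank (insert e A) = rank A" using rank_insert[OF assms eE] e by simp
    then show "e \<in> A" using less eE by (metis DiffI less_irrefl)
  qed
  then show "cl A = A" using cl_extensive[OF assms] by blast
next
  assume "cl A = A"
  then show "\<forall>e\<in>E - A. rank A < rank (insert e A)" using rank_insert[OF assms] by simp
qed

text \<open>
  Bases as minimal spanning sets, the form in which they are defined from cocircuits.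
\<close>

lemma mem_bases_iff: "B \<in> bases \<longleftrightarrow> B \<subseteq> E \<and> cl B = E \<and> (\<forall>B'. B' \<subset> B \<longrightarrow> cl B' \<noteq> E)"
proof (intro iffI conjI allI impI; (elim conjE)?)
  assume B: "B \<in> bases"
  then show BE: "B \<subseteq> E" "cl B = E" by (auto simp: bases_def indep_def)
  fix B' assume "B' \<subset> B"
  then obtain i where i: "i \<in> B" "B' \<subseteq> B - {i}" by blast
  then have "cl B' \<subseteq> cl (B - {i})" using BE by (intro cl_mono) auto
  moreover have "i \<notin> cl (B - {i})" using B i by (auto simp: bases_def indep_def)
  ultimately show "cl B' \<noteq> E" using i(1) BE by blast
next
  assume B: "B \<subseteq> E" "cl B = E" "\<forall>B'. B' \<subset> B \<longrightarrow> cl B' \<noteq> E"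
  have "i \<notin> cl (B - {i})" if i: "i \<in> B" for i
  proof
    assume "i \<in> cl (B - {i})"
    then have "B \<subseteq> cl (B - {i})" using cl_extensive[of "B - {i}"] B(1) by blast
    then have "cl B \<subseteq> cl (B - {i})" using B(1) by (intro cl_least) auto
    then have "cl (B - {i}) = E" using B cl_subset[of "B - {i}"] by blast
    then show False using B(3)[rule_format, of "B - {i}"] i by blast
  qed
  then show "B \<in> bases" using B by (auto simp: bases_def indep_def)
qed

end

section \<open>Flats and covectors of an oriented matroid\<close>

locale covectors =
  fixes E :: "'e set" and \<L> :: "'e sign_vector set"
  assumes om: "oriented_matroid E \<L>"
begin

definition closure :: "'e set \<Rightarrow> 'e set" where
  "closure A = {e \<in> E. \<forall>X\<in>\<L>. (\<forall>a\<in>A. X a = 0) \<longrightarrow> X e = 0}"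

definition zero_set :: "'e sign_vector \<Rightarrow> 'e set" where
  "zero_set X = {e \<in> E. X e = 0}"

text \<open>
  The order of the covector poset: \<open>X\<close> is a face of \<open>Y\<close>.
\<close>

definition conforms :: "'e sign_vector \<Rightarrow> 'e sign_vector \<Rightarrow> bool" where
  "conforms X Y \<longleftrightarrow> (\<forall>e. X e = 0 \<or> X e = Y e)"

lemma finite_ground: "finite E"
  using om by (simp add: oriented_matroid_def)

lemma covector_values: "X \<in> \<L> \<Longrightarrow> X e = 0 \<or> X e = 1 \<or> X e = -1"
  using om by (auto simp: oriented_matroid_def sign_vectors_def subset_iff)

lemma covector_outside: "X \<in> \<L> \<Longrightarrow> X e \<noteq> 0 \<Longrightarrow> e \<in> E"
  using om by (auto simp: oriented_matroid_def sign_vectors_def subset_iff)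

lemma zero_covector: "(\<lambda>e. 0) \<in> \<L>"
  using om by (simp add: oriented_matroid_def)

lemma uminus_covector: "X \<in> \<L> \<Longrightarrow> (\<lambda>e. - X e) \<in> \<L>"
  using om by (simp add: oriented_matroid_def)

lemma compose_covector: "X \<in> \<L> \<Longrightarrow> Y \<in> \<L> \<Longrightarrow> sv_compose X Y \<in> \<L>"
  using om by (simp add: oriented_matroid_def)

lemma eliminate:
  assumes "X \<in> \<L>" "Y \<in> \<L>" "X e \<noteq> 0" "X e = - Y e"
  obtains Z where "Z \<in> \<L>" "Z e = 0"
    "\<And>f. f \<notin> sv_separation X Y \<Longrightarrow> Z f = (if X f \<noteq> 0 then X f else Y f)"
proof -
  have "e \<in> sv_separation X Y" using assms by (simp add: sv_separation_def)
  then obtain Z where Z: "Z \<in> \<L>" "Z e = 0" "\<forall>f\<in>E - sv_separation X Y. Z f = sv_compose X Y f"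
    using om assms(1,2) unfolding oriented_matroid_def by blast
  have "Z f = (if X f \<noteq> 0 then X f else Y f)" if "f \<notin> sv_separation X Y" for f
  proof (cases "f \<in> E")
    case True
    then show ?thesis using Z(3) that by (simp add: sv_compose_def)
  next
    case False
    then show ?thesis using covector_outside Z(1) assms(1,2) by metis
  qed
  then show ?thesis using that Z by blast
qed

lemma finite_covectors: "finite \<L>"
proof (rule finite_subset)
  show "\<L> \<subseteq> {X. \<forall>e. (e \<in> E \<longrightarrow> X e \<in> {-1, 0, 1}) \<and> (e \<notin> E \<longrightarrow> X e = 0)}"
    using om by (auto simp: oriented_matroid_def sign_vectors_def)
  show "finite \<dots>"
    by (rule finite_set_of_finite_funs[OF finite_ground]) simp
qed

lemma zero_set_subset: "zero_set X \<subseteq> E"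
  by (auto simp: zero_set_def)

lemma zero_set_compose: "zero_set (sv_compose X Y) = zero_set X \<inter> zero_set Y"
  by (auto simp: zero_set_def sv_compose_def)

lemma closure_zero_set: "X \<in> \<L> \<Longrightarrow> closure (zero_set X) = zero_set X"
  by (auto simp: zero_set_def closure_def)

text \<open>
  Composition intersects zero sets, so among the covectors that vanish on \<open>A\<close> there is one with the least
  zero set.
\<close>

lemma closure_eq_zero_set:
  assumes "A \<subseteq> E"
  shows "\<exists>X\<in>\<L>. zero_set X = closure A"
proof -
  let ?V = "{X \<in> \<L>. A \<subseteq> zero_set X}"
  have "(\<lambda>e. 0) \<in> ?V" using zero_covector assms by (auto simp: zero_set_def)
  then obtain X where X: "X \<in> ?V" "\<And>Y. Y \<in> ?V \<Longrightarrow> card (zero_set X) \<le> card (zero_set Y)"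
    using finite_ex_min[of ?V "\<lambda>X. card (zero_set X)"] by blast
  have "zero_set X \<subseteq> closure A"
  proof
    fix e assume e: "e \<in> zero_set X"
    have "Y e = 0" if Y: "Y \<in> \<L>" "\<forall>a\<in>A. Y a = 0" for Y
    proof (rule ccontr)
      assume "Y e \<noteq> 0"
      then have "zero_set (sv_compose X Y) \<subset> zero_set X"
        using e unfolding zero_set_compose by (auto simp: zero_set_def)
      then have "card (zero_set (sv_compose X Y)) < card (zero_set X)"
        using finite_subset[OF zero_set_subset finite_ground] by (intro psubset_card_mono)
      moreover have "sv_compose X Y \<in> ?V"
        using X(1) Y assms compose_covector unfolding mem_Collect_eq zero_set_compose
        by (auto simp: zero_set_def)
      ultimately show False using X(2) by (meson leD)
    qed
    then show "e \<in> closure A" using e by (auto simp: closure_def zero_set_def)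
  qed
  moreover have "closure A \<subseteq> zero_set X" using X(1) by (auto simp: closure_def zero_set_def)
  ultimately show ?thesis using X(1) by blast
qed

text \<open>
  If \<open>X\<close> vanishes on \<open>A\<close> and \<open>f\<close> but not at \<open>e\<close>, and \<open>Y\<close> vanishes on \<open>A\<close> but not at \<open>f\<close>, then \<open>Y\<close> does not
  vanish at \<open>e\<close> either, because \<open>f\<close> is in the closure of \<open>A\<close> and \<open>e\<close>. Eliminating \<open>e\<close> between \<open>X\<close> and \<open>Y\<close> or \<open>-Y\<close> produces a covector that vanishes
  on \<open>A\<close> and \<open>e\<close> but not at \<open>f\<close>, which is impossible.
\<close>

lemma closure_exchange:
  assumes "A \<subseteq> E" "e \<in> E" "f \<in> closure (insert e A)" "f \<notin> closure A"
  shows "e \<in> closure (insert f A)"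
proof (rule ccontr)
  assume "e \<notin> closure (insert f A)"
  then obtain X where X: "X \<in> \<L>" "\<forall>a\<in>insert f A. X a = 0" "X e \<noteq> 0"
    using assms(2) by (auto simp: closure_def)
  obtain Y where Y: "Y \<in> \<L>" "\<forall>a\<in>A. Y a = 0" "Y f \<noteq> 0"
    using assms(3,4) by (auto simp: closure_def)
  have "Y e \<noteq> 0" using Y assms(3) by (auto simp: closure_def)
  then have "X e = - Y e \<or> X e = Y e" using covector_values[OF X(1), of e] covector_values[OF Y(1), of e] X(3) by auto
  then obtain Y' where Y': "Y' \<in> \<L>" "\<forall>a\<in>A. Y' a = 0" "Y' f \<noteq> 0" "X e = - Y' e"
    using Y uminus_covector[OF Y(1)] by (metis neg_equal_0_iff_equal minus_minus)
  obtain Z where Z: "Z \<in> \<L>" "Z e = 0" "\<And>g. g \<notin> sv_separation X Y' \<Longrightarrow> Z g = (if X g \<noteq> 0 then X g else Y' g)"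
    using eliminate[OF X(1) Y'(1) X(3) Y'(4)] by blast
  have "Z a = 0" if "a \<in> A" for a
    using Z(3)[of a] that X(2) Y'(2) by (simp add: sv_separation_def)
  moreover have "Z f \<noteq> 0" using Z(3)[of f] X(2) Y'(3) by (simp add: sv_separation_def)
  ultimately show False using Z(1,2) assms(3) by (auto simp: closure_def)
qed

sublocale matroid_closure E closure
proof
  show "closure A \<subseteq> E" for A by (auto simp: closure_def)
  show "A \<subseteq> closure A" if "A \<subseteq> E" for A using that by (auto simp: closure_def)
  show "closure A \<subseteq> closure B" if "A \<subseteq> closure B" "B \<subseteq> E" for A B
    using that by (auto simp: closure_def subset_iff)
qed (fact finite_ground closure_exchange)+

lemma closed_sets: "{A. A \<subseteq> E \<and> closure A = A} = zero_set ` \<L>"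
proof (intro equalityI subsetI)
  fix A assume "A \<in> {A. A \<subseteq> E \<and> closure A = A}"
  then show "A \<in> zero_set ` \<L>" using closure_eq_zero_set[of A] by auto
qed (use closure_zero_set zero_set_subset in auto)

text \<open>
  A covector that vanishes on \<open>B\<close> witnesses that \<open>B\<close> does not span, and its support contains a minimal
  one.
\<close>

lemma spanning_iff_meets_cocircuits:
  assumes "B \<subseteq> E"
  shows "(\<forall>D\<in>cocircuits \<L>. B \<inter> D \<noteq> {}) \<longleftrightarrow> closure B = E"
proof
  assume meets: "\<forall>D\<in>cocircuits \<L>. B \<inter> D \<noteq> {}"
  show "closure B = E"
  proof (rule ccontr)
    assume "closure B \<noteq> E"
    then obtain e X where X: "X \<in> \<L>" "\<forall>a\<in>B. X a = 0" "X e \<noteq> 0"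
      by (auto simp: closure_def)
    let ?F = "{D \<in> sv_support ` \<L> - {{}}. D \<subseteq> sv_support X}"
    have fin: "finite ?F" using finite_covectors by simp
    have "sv_support X \<in> ?F" using X by (auto simp: sv_support_def)
    then obtain D where D: "D \<in> ?F" "\<forall>D'\<in>?F. D' \<subseteq> D \<longrightarrow> D = D'"
      using finite_has_minimal2[OF fin, of "sv_support X"] by auto
    have "D' = D" if D': "D' \<in> sv_support ` \<L> - {{}}" "D' \<subseteq> D" for D'
    proof -
      have "D' \<in> ?F" using D' D(1) by auto
      then show ?thesis using D(2) D'(2) by auto
    qed
    then have "D \<in> cocircuits \<L>" using D(1) by (simp add: cocircuits_def)
    moreover have "B \<inter> D = {}" using D(1) X(2) by (auto simp: sv_support_def)
    ultimately show False using meets by blast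
  qed
next
  assume sp: "closure B = E"
  show "\<forall>D\<in>cocircuits \<L>. B \<inter> D \<noteq> {}"
  proof (intro ballI notI)
    fix D assume "D \<in> cocircuits \<L>" "B \<inter> D = {}"
    then obtain X e where "X \<in> \<L>" "D = sv_support X" "e \<in> D" by (auto simp: cocircuits_def)
    then have X: "X \<in> \<L>" "X e \<noteq> 0" "\<forall>a\<in>B. X a = 0"
      using \<open>B \<inter> D = {}\<close> by (auto simp: sv_support_def)
    then have "e \<notin> closure B" by (auto simp: closure_def)
    then show False using sp covector_outside X by blast
  qed
qed

lemma matroid_bases_eq: "matroid_bases E \<L> = bases"
proof (rule set_eqI)
  fix B
  show "B \<in> matroid_bases E \<L> \<longleftrightarrow> B \<in> bases"
  proof (cases "B \<subseteq> E")
    case True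
    have "(\<exists>D\<in>cocircuits \<L>. B' \<inter> D = {}) \<longleftrightarrow> closure B' \<noteq> E" if "B' \<subset> B" for B'
      using spanning_iff_meets_cocircuits[of B'] that True by auto
    then show ?thesis
      using True spanning_iff_meets_cocircuits[OF True] by (simp add: matroid_bases_def mem_bases_iff)
  qed (simp add: matroid_bases_def mem_bases_iff)
qed

lemma matroid_rank_eq: "matroid_rank E \<L> A = rank A"
  by (simp add: matroid_rank_def rank_def matroid_bases_eq)

lemma flats_eq_closed: "flats E \<L> = {A. A \<subseteq> E \<and> closure A = A}"
  using closed_iff_rank_less by (auto simp: flats_def matroid_rank_eq)

lemma flats_eq: "flats E \<L> = zero_set ` \<L>"
  unfolding flats_eq_closed by (rule closed_sets)

lemma flatD: "A \<in> flats E \<L> \<Longrightarrow> A \<subseteq> E" "A \<in> flats E \<L> \<Longrightarrow> closure A = A"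
  by (auto simp: flats_eq_closed)

lemma closure_flat: "A \<subseteq> E \<Longrightarrow> closure A \<in> flats E \<L>"
  using cl_cl cl_subset by (simp add: flats_eq_closed)

lemma zero_set_flat: "X \<in> \<L> \<Longrightarrow> zero_set X \<in> flats E \<L>"
  by (simp add: flats_eq)

lemma conforms_zero_set:
  assumes "X \<in> \<L>" "Y \<in> \<L>" "conforms X Y" "X \<noteq> Y"
  shows "zero_set Y \<subset> zero_set X"
proof -
  obtain e where e: "X e \<noteq> Y e" using assms(4) by blast
  then have "X e = 0" "Y e \<noteq> 0" using assms(3) by (auto simp: conforms_def)
  moreover have "e \<in> E" using covector_outside[OF assms(2)] \<open>Y e \<noteq> 0\<close> by blast
  ultimately show ?thesis using assms(3) by (auto simp: conforms_def zero_set_def)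
qed

text \<open>
  Eliminating against \<open>Y\<close> strictly shrinks the separation from \<open>Y\<close> while keeping \<open>X\<close> as a face, until
  nothing separates. Positions where \<open>W\<close> agrees with \<open>Y\<close> are never separated and so keep their sign; keeping
  a nonzero sign at a position \<open>g\<close> outside the support of \<open>X\<close> prevents the procedure from collapsing to \<open>X\<close>.
\<close>

lemma conforming_elimination:
  assumes "X \<in> \<L>" "Y \<in> \<L>" "conforms X Y"
    and "W \<in> \<L>" "conforms X W" "zero_set Y \<subset> zero_set W" "W g = Y g"
  shows "\<exists>Z\<in>\<L>. conforms X Z \<and> conforms Z Y \<and> zero_set Y \<subset> zero_set Z \<and> Z g = Y g"
  using assms(4-)
proof (induction "card (sv_separation Y W)" arbitrary: W rule: less_induct)
  case (less W)
  have W: "\<And>e. Y e = 0 \<Longrightarrow> W e = 0"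
    using less.prems(1,3) covector_outside by (auto simp: zero_set_def)
  show ?case
  proof (cases "sv_separation Y W = {}")
    case True
    have "W e = 0 \<or> W e = Y e" for e
    proof (cases "W e = 0")
      case False
      then have "Y e \<noteq> 0" using W by blast
      then show ?thesis
        using True covector_values[OF assms(2), of e] covector_values[OF less.prems(1), of e]
        by (auto simp: sv_separation_def)
    qed simp
    then have "conforms W Y" by (simp add: conforms_def)
    then show ?thesis using less.prems by blast
  next
    case False
    then obtain e where e: "Y e \<noteq> 0" "Y e = - W e" by (auto simp: sv_separation_def)
    obtain Z where Z: "Z \<in> \<L>" "Z e = 0" "\<And>f. f \<notin> sv_separation Y W \<Longrightarrow> Z f = (if Y f \<noteq> 0 then Y f else W f)"
      using eliminate[OF assms(2) less.prems(1) e] by blast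
    have Zx: "Z f = X f" if "X f \<noteq> 0" for f
    proof -
      have "Y f = X f" "W f = X f" using that assms(3) less.prems(2) by (auto simp: conforms_def)
      then show ?thesis using Z(3)[of f] that by (simp add: sv_separation_def)
    qed
    then have "conforms X Z" unfolding conforms_def by metis
    moreover have "Z f = 0" if "Y f = 0" for f
      using Z(3)[of f] that W[OF that] by (simp add: sv_separation_def)
    then have "zero_set Y \<subset> zero_set Z"
      using e(1) Z(2) covector_outside[OF assms(2) e(1)] by (auto simp: zero_set_def)
    moreover have "Z g = Y g"
      using Z(3)[of g] less.prems(4) by (auto simp: sv_separation_def)
    moreover have "card (sv_separation Y Z) < card (sv_separation Y W)"
    proof (rule psubset_card_mono)
      show "finite (sv_separation Y W)"
        using covector_outside[OF assms(2)]
        by (intro finite_subset[OF _ finite_ground]) (auto simp: sv_separation_def)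
      have "sv_separation Y Z \<subseteq> sv_separation Y W"
      proof
        fix f assume "f \<in> sv_separation Y Z"
        then show "f \<in> sv_separation Y W"
          using Z(3)[of f] by (auto simp: sv_separation_def)
      qed
      moreover have "e \<in> sv_separation Y W" "e \<notin> sv_separation Y Z"
        using e Z(2) by (simp_all add: sv_separation_def)
      ultimately show "sv_separation Y Z \<subset> sv_separation Y W" by blast
    qed
    ultimately show ?thesis using less.hyps Z(1) by blast
  qed
qed

text \<open>
  If some flat lies strictly between the zero sets of \<open>Y\<close> and \<open>X\<close>, then a covector with this zero set,
  composed with \<open>X\<close> and with its sign adjusted at one element, is a starting point for
  \<open>conforming_elimination\<close>.
\<close>

lemma covectors_no_gap:
  assumes X: "X \<in> \<L>" and Y: "Y \<in> \<L>" and XY: "conforms X Y"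
    and gap: "rank (zero_set Y) + 1 < rank (zero_set X)"
  shows "\<exists>Z\<in>\<L>. conforms X Z \<and> conforms Z Y \<and> Z \<noteq> X \<and> Z \<noteq> Y"
proof -
  have "X \<noteq> Y" using gap by auto
  then have sub: "zero_set Y \<subseteq> zero_set X" using conforms_zero_set[OF X Y XY] by blast
  obtain C where C: "closure C = C" "zero_set Y \<subset> C" "C \<subset> zero_set X"
    using closed_no_gap[OF sub zero_set_subset closure_zero_set[OF Y] closure_zero_set[OF X] gap] by blast
  then obtain W where W: "W \<in> \<L>" "zero_set W = C"
    using closure_eq_zero_set[of C] zero_set_subset by (metis psubset_imp_subset subset_trans)
  obtain g where g: "g \<in> zero_set X" "g \<notin> C" using C(3) by blast
  have gE: "g \<in> E" "X g = 0" "W g \<noteq> 0" "Y g \<noteq> 0" using g W C(2) by (auto simp: zero_set_def)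
  have "W g = Y g \<or> - W g = Y g"
    using gE covector_values[OF W(1), of g] covector_values[OF Y, of g] by auto
  then obtain V where V: "V \<in> \<L>" "zero_set V = C" "V g = Y g"
    using W uminus_covector[OF W(1)] by (auto simp: zero_set_def)
  have "sv_compose X V g = Y g" using gE V by (simp add: sv_compose_def)
  moreover have "conforms X (sv_compose X V)" by (simp add: conforms_def sv_compose_def)
  moreover have "zero_set Y \<subset> zero_set (sv_compose X V)"
    using C V unfolding zero_set_compose by blast
  ultimately obtain Z where Z: "Z \<in> \<L>" "conforms X Z" "conforms Z Y" "zero_set Y \<subset> zero_set Z" "Z g = Y g"
    using conforming_elimination[OF X Y XY compose_covector[OF X V(1)]] by blast
  then have "Z \<noteq> X" "Z \<noteq> Y" using gE by auto
  then show ?thesis using Z by blast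
qed

text \<open>
  Geometrically the covectors in the sum are the cells of an open cone inside the intersection of the
  hyperplanes in \<open>x\<close>, so the sum is, up to a sign, an Euler characteristic with compact supports. The proof adds the signs of the elements outside \<open>x\<close> and \<open>A\<close>
  one at a time. If the new element \<open>f\<close> has a constant sign on the cone, nothing changes. Otherwise \<open>f\<close>
  cuts the cone into two cones of the same kind and a cone inside the flat spanned by \<open>x\<close> and \<open>f\<close>, whose
  rank is one larger, so that \<open>s = s + s - s\<close> for \<open>s = (-1)\<^bsup>rank x\<^esup>\<close>. When all signs are prescribed,
  a single covector is left.
\<close>

lemma euler_relation:
  fixes \<sigma> :: "'e \<Rightarrow> int"
  assumes "x \<in> flats E \<L>" "A \<subseteq> E - x" "\<And>a. a \<in> A \<Longrightarrow> \<sigma> a \<noteq> 0"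
    and "{X \<in> \<L>. (\<forall>e\<in>x. X e = 0) \<and> (\<forall>a\<in>A. X a = \<sigma> a)} \<noteq> {}"
  shows "(\<Sum>X | X \<in> \<L> \<and> (\<forall>e\<in>x. X e = 0) \<and> (\<forall>a\<in>A. X a = \<sigma> a). (-1) ^ rank (zero_set X)) =
    ((-1) ^ rank x :: rat)"
  using assms
proof (induction "card (E - x - A)" arbitrary: x A \<sigma> rule: less_induct)
  case (less x A \<sigma>)
  let ?R = "\<lambda>x A \<sigma>. {X \<in> \<L>. (\<forall>e\<in>x. X e = 0) \<and> (\<forall>a\<in>A. X a = \<sigma> a)}"
  let ?s = "\<lambda>X. (-1::rat) ^ rank (zero_set X)"
  have x: "x \<subseteq> E" "closure x = x" using less.prems(1) flatD by auto
  obtain X0 where X0: "X0 \<in> ?R x A \<sigma>" using less.prems(4) by blast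
  show ?case
  proof (cases "E - x - A = {}")
    case True
    have unique: "X = X0" if "X \<in> ?R x A \<sigma>" for X
    proof
      fix e
      show "X e = X0 e"
      proof (cases "e \<in> E")
        case e: True
        then show ?thesis using that X0 True by (cases "e \<in> x") auto
      next
        case False
        then have "X e = 0" "X0 e = 0" using covector_outside that X0 by blast+
        then show ?thesis by simp
      qed
    qed
    then have "?R x A \<sigma> = {X0}" using X0 by blast
    moreover have "zero_set X0 = x"
    proof (intro equalityI subsetI)
      fix e assume e: "e \<in> zero_set X0"
      show "e \<in> x"
      proof (rule ccontr)
        assume "e \<notin> x"
        then have "e \<in> A" using e True by (auto simp: zero_set_def)
        then show False using e X0 less.prems(3)[of e] by (auto simp: zero_set_def)
      qed
    qed (use X0 x(1) in \<open>auto simp: zero_set_def\<close>)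
    ultimately show ?thesis by simp
  next
    case False
    then obtain f where f: "f \<in> E" "f \<notin> x" "f \<notin> A" by blast
    have A': "insert f A \<subseteq> E - x" using f less.prems(2) by blast
    have "E - x - insert f A \<subset> E - x - A" using f by blast
    then have c1: "card (E - x - insert f A) < card (E - x - A)"
      using finite_ground by (intro psubset_card_mono) auto
    have side: "(\<Sum>X\<in>?R x (insert f A) (\<sigma>(f := c)). ?s X) = (-1) ^ rank x"
      if "?R x (insert f A) (\<sigma>(f := c)) \<noteq> {}" "c \<noteq> 0" for c
      by (rule less.hyps[OF c1 less.prems(1) A' _ that(1)]) (use less.prems(3) that(2) in auto)
    have side_eq: "?R x (insert f A) (\<sigma>(f := c)) = {X \<in> ?R x A \<sigma>. X f = c}" for c
      using f(3) by auto
    show ?thesis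
    proof (cases "\<exists>X1\<in>?R x A \<sigma>. X1 f = 0")
      case no: False
      \<comment> \<open>two covectors of opposite sign at \<open>f\<close> would yield one that vanishes at \<open>f\<close>\<close>
      have "X f = X0 f" if X: "X \<in> ?R x A \<sigma>" for X
      proof (rule ccontr)
        assume ne: "X f \<noteq> X0 f"
        have "X f \<noteq> 0" "X0 f \<noteq> 0" using no X X0 by blast+
        then have "X f = - X0 f"
          using ne X X0 covector_values[of X f] covector_values[of X0 f] by auto
        then obtain Z where Z: "Z \<in> \<L>" "Z f = 0" "\<And>g. g \<notin> sv_separation X X0 \<Longrightarrow> Z g = (if X g \<noteq> 0 then X g else X0 g)"
          using eliminate[of X X0 f] X X0 \<open>X f \<noteq> 0\<close> by blast
        have "Z g = 0" if "g \<in> x" for g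
          using Z(3)[of g] X X0 that by (simp add: sv_separation_def)
        moreover have "Z a = \<sigma> a" if "a \<in> A" for a
          using Z(3)[of a] X X0 that less.prems(3)[OF that] by (simp add: sv_separation_def)
        ultimately have "Z \<in> ?R x A \<sigma>" using Z(1) by blast
        then show False using no Z(2) by blast
      qed
      then have "?R x A \<sigma> = ?R x (insert f A) (\<sigma>(f := X0 f))" unfolding side_eq by blast
      moreover have "X0 f \<noteq> 0" using no X0 by blast
      ultimately show ?thesis using side[of "X0 f"] less.prems(4) by argo
    next
      case True
      then obtain X1 where X1: "X1 \<in> ?R x A \<sigma>" "X1 f = 0" by blast
      have "f \<notin> closure x" using f x by simp
      then obtain Y where Y: "Y \<in> \<L>" "\<forall>e\<in>x. Y e = 0" "Y f \<noteq> 0"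
        using f(1) by (auto simp: closure_def)
      \<comment> \<open>both sides of \<open>f\<close> occur: perturb a covector on \<open>f\<close> by \<open>Y\<close> or \<open>-Y\<close>\<close>
      have ne: "{X \<in> ?R x A \<sigma>. X f = c} \<noteq> {}" if "c = 1 \<or> c = -1" for c :: int
      proof -
        obtain Y' where Y': "Y' \<in> \<L>" "\<forall>e\<in>x. Y' e = 0" "Y' f = c"
        proof (cases "Y f = c")
          case True
          then show ?thesis using that Y by blast
        next
          case False
          then have "- Y f = c" using \<open>c = 1 \<or> c = -1\<close> covector_values[OF Y(1), of f] Y(3) by auto
          then show ?thesis using that[of "\<lambda>e. - Y e"] Y uminus_covector by auto
        qed
        have "sv_compose X1 Y' \<in> {X \<in> ?R x A \<sigma>. X f = c}"
          using X1 Y' less.prems(3) compose_covector by (auto simp: sv_compose_def)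
        then show ?thesis by blast
      qed
      let ?x' = "closure (insert f x)"
      have fx: "insert f x \<subseteq> E" using f x by blast
      have zero: "?R ?x' A \<sigma> = {X \<in> ?R x A \<sigma>. X f = 0}"
        using cl_extensive[OF fx] by (auto simp: closure_def)
      have R0: "(\<Sum>X\<in>?R ?x' A \<sigma>. ?s X) = (-1) ^ rank ?x'"
      proof (rule less.hyps)
        show "?x' \<in> flats E \<L>" by (rule closure_flat[OF fx])
        have X1R: "X1 \<in> ?R ?x' A \<sigma>" unfolding zero using X1 by blast
        then show "?R ?x' A \<sigma> \<noteq> {}" by blast
        show "A \<subseteq> E - ?x'" using less.prems(2,3) X1R by force
        have "E - ?x' - A \<subset> E - x - A" using f cl_extensive[OF fx] by blast
        then show "card (E - ?x' - A) < card (E - x - A)"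
          using finite_ground by (intro psubset_card_mono) auto
      qed (use less.prems(3) in auto)
      have "?R x A \<sigma> = {X \<in> ?R x A \<sigma>. X f = 0} \<union> {X \<in> ?R x A \<sigma>. X f = 1} \<union> {X \<in> ?R x A \<sigma>. X f = -1}"
        using covector_values by blast
      then have "(\<Sum>X\<in>?R x A \<sigma>. ?s X) = (\<Sum>X\<in>{X \<in> ?R x A \<sigma>. X f = 0} \<union> {X \<in> ?R x A \<sigma>. X f = 1} \<union> {X \<in> ?R x A \<sigma>. X f = -1}. ?s X)"
        by argo
      also have "\<dots> = (\<Sum>X\<in>{X \<in> ?R x A \<sigma>. X f = 0}. ?s X) +
          (\<Sum>X\<in>{X \<in> ?R x A \<sigma>. X f = 1}. ?s X) + (\<Sum>X\<in>{X \<in> ?R x A \<sigma>. X f = -1}. ?s X)"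
        using finite_covectors by (subst sum.union_disjoint; (subst sum.union_disjoint)?) auto
      also have "\<dots> = (-1) ^ rank ?x' + (-1) ^ rank x + (-1) ^ rank x"
        using R0 side[of 1] side[of "-1"] ne unfolding side_eq zero by simp
      also have "rank ?x' = rank x + 1"
        using rank_cl_insert[OF x(1) f(1)] f(2) x(2) by simp
      finally show ?thesis by simp
    qed
  qed
qed

end

section \<open>Flags of flats and flags of faces\<close>

context covectors
begin

abbreviation "flat_poset \<equiv> adjoin_bot (geometric_lattice E \<L>)"
abbreviation "face_poset \<equiv> dual_face_lattice \<L>"

definition flat_rank :: "'e set option \<Rightarrow> nat" where
  "flat_rank p = (case p of None \<Rightarrow> 0 | Some A \<Rightarrow> rank A + 1)"

definition covector_rank :: "'e sign_vector option \<Rightarrow> nat" where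
  "covector_rank p = (case p of None \<Rightarrow> 0 | Some X \<Rightarrow> rank (zero_set X) + 1)"

lemma flat_rank_simps [simp]: "flat_rank None = 0" "flat_rank (Some A) = rank A + 1"
  by (simp_all add: flat_rank_def)

lemma covector_rank_simps [simp]: "covector_rank None = 0" "covector_rank (Some X) = rank (zero_set X) + 1"
  by (simp_all add: covector_rank_def)

lemma Field_geometric_lattice: "Field (geometric_lattice E \<L>) = flats E \<L>"
  by (auto simp: geometric_lattice_def Field_def)

lemma flat_poset_simps [simp]:
  "(None, None) \<in> flat_poset"
  "(None, Some A) \<in> flat_poset \<longleftrightarrow> A \<in> flats E \<L>"
  "(Some A, None) \<notin> flat_poset"
  "(Some A, Some B) \<in> flat_poset \<longleftrightarrow> A \<in> flats E \<L> \<and> B \<in> flats E \<L> \<and> A \<subseteq> B"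
  unfolding adjoin_bot_def Field_geometric_lattice
  by (auto simp: geometric_lattice_def)

lemma Field_flat_poset: "Field flat_poset = insert None (Some ` flats E \<L>)"
proof (intro equalityI subsetI)
  fix p assume "p \<in> Field flat_poset"
  then obtain q where "(p, q) \<in> flat_poset \<or> (q, p) \<in> flat_poset" by (auto simp: Field_def)
  then show "p \<in> insert None (Some ` flats E \<L>)" by (cases p; cases q) auto
next
  fix p assume "p \<in> insert None (Some ` flats E \<L>)"
  then have "(p, p) \<in> flat_poset" by (cases p) (auto simp: conforms_def)
  then show "p \<in> Field flat_poset" by (rule FieldI1)
qed

lemma Field_covector_poset: "Field (covector_poset \<L>) = \<L>"
  by (auto simp: covector_poset_def Field_def)

lemma face_poset_simps [simp]:
  "(None, None) \<in> face_poset"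
  "(None, Some X) \<in> face_poset \<longleftrightarrow> X \<in> \<L>"
  "(Some X, None) \<notin> face_poset"
  "(Some Y, Some X) \<in> face_poset \<longleftrightarrow> X \<in> \<L> \<and> Y \<in> \<L> \<and> conforms X Y"
  unfolding dual_face_lattice_def face_lattice_def adjoin_top_def Field_covector_poset
  by (auto simp: covector_poset_def conforms_def)

lemma Field_face_poset: "Field face_poset = insert None (Some ` \<L>)"
proof (intro equalityI subsetI)
  fix p assume "p \<in> Field face_poset"
  then obtain q where "(p, q) \<in> face_poset \<or> (q, p) \<in> face_poset" by (auto simp: Field_def)
  then show "p \<in> insert None (Some ` \<L>)" by (cases p; cases q) auto
next
  fix p assume "p \<in> insert None (Some ` \<L>)"
  then have "(p, p) \<in> face_poset" by (cases p) (auto simp: conforms_def)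
  then show "p \<in> Field face_poset" by (rule FieldI1)
qed

lemma conforms_refl: "conforms X X"
  by (simp add: conforms_def)

lemma conforms_trans: "conforms X Y \<Longrightarrow> conforms Y Z \<Longrightarrow> conforms X Z"
  unfolding conforms_def by metis

lemma conforms_antisym: "conforms X Y \<Longrightarrow> conforms Y X \<Longrightarrow> X = Y"
  unfolding conforms_def by (intro ext) metis

lemma ground_flat: "E \<in> flats E \<L>"
  using cl_extensive[of E] cl_subset[of E] by (auto simp: flats_eq_closed)

lemma bottom_flat: "closure {} \<in> flats E \<L>" "A \<in> flats E \<L> \<Longrightarrow> closure {} \<subseteq> A"
  using closure_flat[of "{}"] cl_mono[of "{}" A] flatD[of A] by auto

lemma finite_flats: "finite (flats E \<L>)"
  unfolding flats_eq using finite_covectors by simp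

sublocale flat: rank_function flat_poset flat_rank None "Some E"
proof
  show "Partial_order flat_poset"
    unfolding partial_order_on_def preorder_on_def refl_on_def
  proof (intro conjI ballI)
    show "flat_poset \<subseteq> Field flat_poset \<times> Field flat_poset" by (auto intro: FieldI1 FieldI2)
    show "(p, p) \<in> flat_poset" if "p \<in> Field flat_poset" for p
      using that by (auto simp: Field_flat_poset conforms_refl)
    show "antisym flat_poset"
    proof (rule antisymI)
      fix p q assume "(p, q) \<in> flat_poset" "(q, p) \<in> flat_poset"
      then show "p = q" by (cases p; cases q) auto
    qed
    show "trans flat_poset"
    proof (rule transI)
      fix p q s assume "(p, q) \<in> flat_poset" "(q, s) \<in> flat_poset"
      then show "(p, s) \<in> flat_poset" by (cases p; cases q; cases s) auto
    qed
  qed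
  show "finite (Field flat_poset)" using finite_flats by (simp add: Field_flat_poset)
  show "Some E \<in> Field flat_poset" using ground_flat by (simp add: Field_flat_poset)
  show "(p, Some E) \<in> flat_poset" if "p \<in> Field flat_poset" for p
    using that ground_flat flatD by (auto simp: Field_flat_poset)
  show "flat_rank p < flat_rank q" if "(p, q) \<in> flat_poset" "p \<noteq> q" for p q
  proof (cases p; cases q)
    fix A B assume "p = Some A" "q = Some B"
    then show ?thesis using that rank_closed_less[of A B] flatD by auto
  qed (use that in auto)
  show "\<exists>s. (p, s) \<in> flat_poset \<and> (s, q) \<in> flat_poset \<and> s \<noteq> p \<and> s \<noteq> q"
    if pq: "(p, q) \<in> flat_poset" "flat_rank p + 1 < flat_rank q" for p q
  proof (cases q)
    case None
    then show ?thesis using pq(2) by simp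
  next
    case (Some B)
    show ?thesis
    proof (cases p)
      case None
      have "rank (closure {}) \<noteq> rank B" using pq(2) None Some rank_cl_empty by simp
      then have "closure {} \<noteq> B" by auto
      then show ?thesis
        using pq None Some bottom_flat by (intro exI[of _ "Some (closure {})"]) auto
    next
      case p: (Some A)
      have AB: "A \<in> flats E \<L>" "B \<in> flats E \<L>" "A \<subseteq> B" using pq(1) p Some by auto
      have gap: "rank A + 1 < rank B" using pq(2) p Some by simp
      obtain C where C: "closure C = C" "A \<subset> C" "C \<subset> B"
        using closed_no_gap[OF AB(3) flatD(1)[OF AB(2)] flatD(2)[OF AB(1)] flatD(2)[OF AB(2)] gap]
        by blast
      then have "C \<in> flats E \<L>" using flatD(1)[OF AB(2)] by (auto simp: flats_eq_closed)
      then show ?thesis using AB C p Some by (intro exI[of _ "Some C"]) auto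
    qed
  qed
qed (auto simp: Field_flat_poset)

sublocale face: rank_function face_poset covector_rank None "Some (\<lambda>e. 0)"
proof
  show "Partial_order face_poset"
    unfolding partial_order_on_def preorder_on_def refl_on_def
  proof (intro conjI ballI)
    show "face_poset \<subseteq> Field face_poset \<times> Field face_poset" by (auto intro: FieldI1 FieldI2)
    show "(p, p) \<in> face_poset" if "p \<in> Field face_poset" for p
      using that by (auto simp: Field_face_poset conforms_refl)
    show "antisym face_poset"
    proof (rule antisymI)
      fix p q assume "(p, q) \<in> face_poset" "(q, p) \<in> face_poset"
      then show "p = q" by (cases p; cases q) (auto intro: conforms_antisym)
    qed
    show "trans face_poset"
    proof (rule transI)
      fix p q s assume "(p, q) \<in> face_poset" "(q, s) \<in> face_poset"
      then show "(p, s) \<in> face_poset" by (cases p; cases q; cases s) (auto intro: conforms_trans)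
    qed
  qed
  show "finite (Field face_poset)" using finite_covectors by (simp add: Field_face_poset)
  show "Some (\<lambda>e. 0) \<in> Field face_poset" using zero_covector by (simp add: Field_face_poset)
  show "(p, Some (\<lambda>e. 0)) \<in> face_poset" if "p \<in> Field face_poset" for p
    using that zero_covector by (auto simp: Field_face_poset conforms_def)
  show "covector_rank p < covector_rank q" if "(p, q) \<in> face_poset" "p \<noteq> q" for p q
  proof (cases p; cases q)
    fix Y X assume *: "p = Some Y" "q = Some X"
    then have "zero_set Y \<subset> zero_set X" using that conforms_zero_set[of X Y] by auto
    then show ?thesis
      using * that rank_closed_less[of "zero_set Y" "zero_set X"] closure_zero_set zero_set_subset by auto
  qed (use that in auto)
  show "\<exists>s. (p, s) \<in> face_poset \<and> (s, q) \<in> face_poset \<and> s \<noteq> p \<and> s \<noteq> q"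
    if pq: "(p, q) \<in> face_poset" "covector_rank p + 1 < covector_rank q" for p q
  proof (cases q)
    case None
    then show ?thesis using pq(2) by simp
  next
    case (Some X)
    then have X: "X \<in> \<L>" using pq(1) by (cases p) auto
    show ?thesis
    proof (cases p)
      case None
      obtain Y where Y: "Y \<in> \<L>" "zero_set Y = closure {}"
        using closure_eq_zero_set[of "{}"] by auto
      have "zero_set (sv_compose X Y) = closure {}"
        unfolding zero_set_compose Y(2) using bottom_flat(2)[OF zero_set_flat[OF X]] by blast
      then have "sv_compose X Y \<noteq> X" using pq(2) None Some rank_cl_empty by auto
      moreover have "conforms X (sv_compose X Y)" by (simp add: conforms_def sv_compose_def)
      ultimately show ?thesis
        using X Y None Some compose_covector by (intro exI[of _ "Some (sv_compose X Y)"]) auto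
    next
      case p: (Some Y)
      obtain Z where "Z \<in> \<L>" "conforms X Z" "conforms Z Y" "Z \<noteq> X" "Z \<noteq> Y"
        using covectors_no_gap[of X Y] pq p Some by auto
      then show ?thesis using pq(1) p Some by (intro exI[of _ "Some Z"]) auto
    qed
  qed
qed (auto simp: Field_face_poset)

lemma between_flats:
  assumes "A \<in> flats E \<L>" "B \<in> flats E \<L>"
  shows "flat.between (Some A) (Some B) = Some ` {C \<in> flats E \<L>. A \<subset> C \<and> C \<subset> B}"
proof (rule set_eqI)
  fix p show "p \<in> flat.between (Some A) (Some B) \<longleftrightarrow> p \<in> Some ` {C \<in> flats E \<L>. A \<subset> C \<and> C \<subset> B}"
    using assms by (cases p) (auto simp: flat.between_def)
qed

lemma between_bottom_flat:
  assumes "B \<in> flats E \<L>"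
  shows "flat.between None (Some B) = Some ` {C \<in> flats E \<L>. C \<subset> B}"
proof (rule set_eqI)
  fix p show "p \<in> flat.between None (Some B) \<longleftrightarrow> p \<in> Some ` {C \<in> flats E \<L>. C \<subset> B}"
    using assms by (cases p) (auto simp: flat.between_def)
qed

text \<open>
  The possible next covectors in a chain of faces, when the chain so far ends at \<open>X\<close> and the next
  flat is to be \<open>x\<close>.
\<close>

definition fibre :: "'e sign_vector \<Rightarrow> 'e set \<Rightarrow> 'e sign_vector set" where
  "fibre X x = {Y \<in> \<L>. conforms X Y \<and> zero_set Y = x}"

lemma fibre_self: "X \<in> \<L> \<Longrightarrow> fibre X (zero_set X) = {X}"
  using conforms_zero_set conforms_refl by (fastforce simp: fibre_def)

text \<open>
  Euler's relation for the star of \<open>X\<close>, the set of covectors that agree with \<open>X\<close> outside its zero set,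
  grouped by zero sets.
\<close>

lemma sum_fibres:
  assumes X: "X \<in> \<L>" and x: "x \<in> flats E \<L>" "x \<subseteq> zero_set X"
  shows "(\<Sum>z | z \<in> flats E \<L> \<and> x \<subseteq> z \<and> z \<subseteq> zero_set X. (-1) ^ rank z * of_nat (card (fibre X z))) =
    ((-1) ^ rank x :: rat)"
proof -
  let ?R = "{Y \<in> \<L>. (\<forall>e\<in>x. Y e = 0) \<and> (\<forall>a\<in>E - zero_set X. Y a = X a)}"
  let ?F = "{z \<in> flats E \<L>. x \<subseteq> z \<and> z \<subseteq> zero_set X}"
  have conf: "conforms X Y \<longleftrightarrow> (\<forall>a\<in>E - zero_set X. Y a = X a)" if "Y \<in> \<L>" for Y
  proof
    assume "conforms X Y"
    then show "\<forall>a\<in>E - zero_set X. Y a = X a" by (auto simp: conforms_def zero_set_def)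
  next
    assume eq: "\<forall>a\<in>E - zero_set X. Y a = X a"
    have "X e = Y e" if "X e \<noteq> 0" for e
      using covector_outside[OF X that] that eq by (auto simp: zero_set_def)
    then show "conforms X Y" unfolding conforms_def by blast
  qed
  have sub: "zero_set Y \<subseteq> zero_set X" if "conforms X Y" for Y
    using that by (auto simp: conforms_def zero_set_def)
  have R: "?R = {Y \<in> \<L>. conforms X Y \<and> x \<subseteq> zero_set Y}"
    using conf flatD(1)[OF x(1)] by (auto simp: zero_set_def)
  have "X \<in> ?R" unfolding R using X x(2) conforms_refl by blast
  then have "(\<Sum>Y\<in>?R. (-1) ^ rank (zero_set Y)) = ((-1) ^ rank x :: rat)"
    by (intro euler_relation[OF x(1)]) (use x in \<open>auto simp: zero_set_def\<close>)
  also have "(\<Sum>Y\<in>?R. (-1) ^ rank (zero_set Y)) =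
      (\<Sum>z\<in>?F. \<Sum>Y | Y \<in> ?R \<and> zero_set Y = z. (-1::rat) ^ rank (zero_set Y))"
    using finite_covectors finite_flats zero_set_flat sub
    by (intro sum.group[symmetric]) (auto simp: R)
  also have "\<dots> = (\<Sum>z\<in>?F. (-1) ^ rank z * of_nat (card (fibre X z)))"
  proof (rule sum.cong[OF refl])
    fix z assume "z \<in> ?F"
    then have "{Y \<in> ?R. zero_set Y = z} = fibre X z" unfolding R by (auto simp: fibre_def)
    then show "(\<Sum>Y | Y \<in> ?R \<and> zero_set Y = z. (-1::rat) ^ rank (zero_set Y)) =
        (-1) ^ rank z * of_nat (card (fibre X z))"
      by (simp add: fibre_def)
  qed
  finally show ?thesis by simp
qed

text \<open>
  Isolating the terms \<open>z = x\<close> and \<open>z = zero_set X\<close> in \<open>sum_fibres\<close> gives the recursion \<open>gap_weight_rec\<close> up to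
  the factor 2: the fibre over \<open>zero_set X\<close> is a single covector, and \<open>1 - (-1)\<^bsup>d\<^esup>\<close> is 2 for odd \<open>d\<close> and 0 for
  even \<open>d\<close>.
\<close>

lemma card_fibre:
  assumes X: "X \<in> \<L>" and "x \<in> flats E \<L>" "x \<subset> zero_set X"
  shows "of_nat (card (fibre X x)) = 2 * flat.gap_weight (Some x) (Some (zero_set X))"
  using assms(2-)
proof (induction "rank (zero_set X) - rank x" arbitrary: x rule: less_induct)
  case (less x)
  let ?y = "zero_set X"
  let ?B = "{z \<in> flats E \<L>. x \<subset> z \<and> z \<subset> ?y}"
  let ?g = "\<lambda>z. flat.gap_weight (Some z) (Some ?y)"
  have y: "?y \<in> flats E \<L>" by (rule zero_set_flat[OF X])
  have rxy: "rank x < rank ?y"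
    using rank_closed_less[OF less.prems(2) zero_set_subset] flatD(2)[OF less.prems(1)] by simp
  have finB: "finite ?B" using finite_flats by simp
  have IH: "of_nat (card (fibre X z)) = 2 * ?g z" if z: "z \<in> ?B" for z
  proof (rule less.hyps)
    have "rank x < rank z" using rank_closed_less[of x z] z flatD less.prems(1) by auto
    moreover have "rank z < rank ?y" using rank_closed_less[of z ?y] z flatD zero_set_subset by auto
    ultimately show "rank ?y - rank z < rank ?y - rank x" by linarith
  qed (use z in auto)
  have "{z \<in> flats E \<L>. x \<subseteq> z \<and> z \<subseteq> ?y} = insert x (insert ?y ?B)"
    using less.prems y by auto
  then have "(-1) ^ rank x = (\<Sum>z\<in>insert x (insert ?y ?B). (-1::rat) ^ rank z * of_nat (card (fibre X z)))"
    using sum_fibres[OF X less.prems(1)] less.prems(2) by auto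
  also have "\<dots> = (-1) ^ rank x * of_nat (card (fibre X x)) + ((-1) ^ rank ?y +
      (\<Sum>z\<in>?B. (-1) ^ rank z * (2 * ?g z)))"
    using finB less.prems(2) fibre_self[OF X] IH by (simp add: psubset_eq)
  finally have "(-1) ^ rank x * ((-1) ^ rank x :: rat) = (-1) ^ rank x * ((-1) ^ rank x * of_nat (card (fibre X x)) +
      ((-1) ^ rank ?y + (\<Sum>z\<in>?B. (-1) ^ rank z * (2 * ?g z))))" by simp
  then have "1 = of_nat (card (fibre X x)) + (-1) ^ (rank ?y + rank x) +
      2 * (\<Sum>z\<in>?B. (-1) ^ (rank z + rank x) * ?g z)"
    by (simp add: algebra_simps sum_distrib_left power_add flip: power_mult_distrib)
  moreover have "?g x = (if odd (rank ?y - rank x) then 1 else 0) -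
      (\<Sum>z\<in>?B. (-1) ^ (rank z + rank x) * ?g z)"
    using less.prems y
    by (subst flat.gap_weight_rec) (auto simp: between_flats sum.reindex psubset_imp_subset)
  moreover have "(-1::rat) ^ (rank ?y + rank x) = 1 - 2 * (if odd (rank ?y - rank x) then 1 else 0)"
    using rxy by auto
  ultimately show ?case by simp
qed

text \<open>
  The new minimum has exactly one cover, the least flat \<open>closure {}\<close>. In the recursion for \<open>None\<close>, the larger
  flats contribute the terms of the recursion for this flat with opposite signs. All gap weights cancel, and
  of the two remaining parity terms exactly one is 1.
\<close>

lemma gap_weight_bottom:
  assumes "y \<in> flats E \<L>"
  shows "flat.gap_weight None (Some y) = 1"
proof -
  let ?g = "\<lambda>z. flat.gap_weight (Some z) (Some y)"
  let ?o = "closure {}"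
  let ?B = "{z \<in> flats E \<L>. ?o \<subset> z \<and> z \<subset> y}"
  have g: "flat.gap_weight None (Some y) = (if odd (rank y + 1) then 1 else 0) -
      (\<Sum>z | z \<in> flats E \<L> \<and> z \<subset> y. (-1) ^ (rank z + 1) * ?g z)"
    using assms by (subst flat.gap_weight_rec) (auto simp: between_bottom_flat sum.reindex)
  show ?thesis
  proof (cases "y = ?o")
    case True
    then have none: "{z. z \<in> flats E \<L> \<and> z \<subset> y} = {}" using bottom_flat(2) by blast
    show ?thesis unfolding g none using rank_cl_empty True by simp
  next
    case False
    have finB: "finite ?B" using finite_flats by simp
    have "{z. z \<in> flats E \<L> \<and> z \<subset> y} = insert ?o ?B"
      using False bottom_flat assms by auto
    then have "(\<Sum>z | z \<in> flats E \<L> \<and> z \<subset> y. (-1) ^ (rank z + 1) * ?g z) =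
        - ?g ?o + (\<Sum>z\<in>?B. (-1) ^ (rank z + 1) * ?g z)"
      using finB rank_cl_empty by simp
    moreover have "?g ?o = (if odd (rank y) then 1 else 0) - (\<Sum>z\<in>?B. (-1) ^ rank z * ?g z)"
      using False assms bottom_flat rank_cl_empty
      by (subst flat.gap_weight_rec) (auto simp: between_flats sum.reindex)
    ultimately show ?thesis unfolding g by (simp add: sum_negf)
  qed
qed

text \<open>
  Both sides split off the element of largest rank in \<open>U\<close>. The covectors that can be this element are grouped
  by their zero sets; each group is a fibre and contributes the factor \<open>2 * gap_weight\<close>.
\<close>

lemma flags_eq_weight:
  assumes "X \<in> \<L>" "U \<subseteq> {1..rank (zero_set X)}"
  shows "of_nat (face.flags (Some X) U) = 2 ^ card U * flat.weight (Some (zero_set X)) U"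
  using assms
proof (induction "card U" arbitrary: U X rule: less_induct)
  case (less U X)
  let ?y = "zero_set X"
  have finU: "finite U" using less.prems(2) finite_subset by blast
  have y: "?y \<in> flats E \<L>" by (rule zero_set_flat[OF less.prems(1)])
  show ?case
  proof (cases "U = {}")
    case True
    then show ?thesis
      using gap_weight_bottom[OF y] by (simp add: face.flags_empty flat.weight_empty)
  next
    case False
    define u where "u = Max U"
    have u: "u \<in> U" "\<And>v. v \<in> U \<Longrightarrow> v \<le> u" using False finU by (auto simp: u_def)
    have u1: "1 \<le> u" "u \<le> rank ?y" using less.prems(2) u(1) by auto
    let ?U = "U - {u}"
    have cU: "card U = Suc (card ?U)" using card_Suc_Diff1[OF finU u(1)] by simp
    have U': "?U \<subseteq> {1..u - 1}"
    proof
      fix v assume "v \<in> ?U"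
      then have "v \<le> u" "v \<noteq> u" "1 \<le> v" using u(2) less.prems(2) by auto
      then show "v \<in> {1..u - 1}" by simp
    qed
    let ?Y = "{Y \<in> \<L>. conforms X Y \<and> rank (zero_set Y) + 1 = u}"
    let ?x = "{x \<in> flats E \<L>. x \<subseteq> ?y \<and> rank x + 1 = u}"
    have "{p. (p, Some X) \<in> face_poset \<and> covector_rank p = u} = Some ` ?Y"
    proof (rule set_eqI)
      fix p show "p \<in> {p. (p, Some X) \<in> face_poset \<and> covector_rank p = u} \<longleftrightarrow> p \<in> Some ` ?Y"
        using u1 less.prems(1) by (cases p) auto
    qed
    then have "face.flags (Some X) U = (\<Sum>Y\<in>?Y. face.flags (Some Y) ?U)"
      using less.prems(2) u by (subst face.flags_rec[of _ _ u]) (auto simp: sum.reindex)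
    then have "of_nat (face.flags (Some X) U) = (\<Sum>Y\<in>?Y. of_nat (face.flags (Some Y) ?U) :: rat)"
      by simp
    also have "\<dots> = (\<Sum>Y\<in>?Y. 2 ^ card ?U * flat.weight (Some (zero_set Y)) ?U)"
    proof (rule sum.cong[OF refl])
      fix Y assume "Y \<in> ?Y"
      then show "of_nat (face.flags (Some Y) ?U) = 2 ^ card ?U * flat.weight (Some (zero_set Y)) ?U"
        using cU U' by (intro less.hyps) auto
    qed
    also have "\<dots> = (\<Sum>x\<in>?x. \<Sum>Y | Y \<in> ?Y \<and> zero_set Y = x. 2 ^ card ?U * flat.weight (Some (zero_set Y)) ?U)"
      using finite_covectors finite_flats zero_set_flat
      by (intro sum.group[symmetric]) (auto simp: conforms_def zero_set_def)
    also have "\<dots> = (\<Sum>x\<in>?x. 2 ^ card U * (flat.weight (Some x) ?U * flat.gap_weight (Some x) (Some ?y)))"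
    proof (rule sum.cong[OF refl])
      fix x assume x: "x \<in> ?x"
      have "{Y \<in> ?Y. zero_set Y = x} = fibre X x" using x by (auto simp: fibre_def)
      then have "(\<Sum>Y | Y \<in> ?Y \<and> zero_set Y = x. 2 ^ card ?U * flat.weight (Some (zero_set Y)) ?U) =
          of_nat (card (fibre X x)) * (2 ^ card ?U * flat.weight (Some x) ?U)"
        by (simp add: fibre_def)
      also have "x \<subset> ?y" using x u1 by auto
      then have "of_nat (card (fibre X x)) = 2 * flat.gap_weight (Some x) (Some ?y)"
        using x less.prems(1) by (intro card_fibre) auto
      finally show "(\<Sum>Y | Y \<in> ?Y \<and> zero_set Y = x. 2 ^ card ?U * flat.weight (Some (zero_set Y)) ?U) =
          2 ^ card U * (flat.weight (Some x) ?U * flat.gap_weight (Some x) (Some ?y))"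
        unfolding cU by simp
    qed
    also have "\<dots> = 2 ^ card U * flat.weight (Some ?y) U"
    proof -
      have "{p. (p, Some ?y) \<in> flat_poset \<and> flat_rank p = u} = Some ` ?x"
      proof (rule set_eqI)
        fix p show "p \<in> {p. (p, Some ?y) \<in> flat_poset \<and> flat_rank p = u} \<longleftrightarrow> p \<in> Some ` ?x"
          using u1 y by (cases p) auto
      qed
      then have "flat.weight (Some ?y) U = (\<Sum>x\<in>?x. flat.weight (Some x) ?U * flat.gap_weight (Some x) (Some ?y))"
        using less.prems(2) u y
        by (subst flat.weight_rec[of _ _ u]) (auto simp: sum.reindex Field_flat_poset)
      then show ?thesis by (simp add: sum_distrib_left)
    qed
    finally show ?thesis .
  qed
qed

lemma zero_set_zero: "zero_set (\<lambda>e. 0) = E"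
  by (simp add: zero_set_def)

lemma vartheta_qsym_flats:
  "vartheta (qsym_of_poset flat_poset) = 2 *\<^sub>q qsym_of_poset face_poset"
proof -
  let ?n = "rank E"
  have n: "poset_rank flat_poset - 1 = ?n" "poset_rank face_poset - 1 = ?n"
    by (simp_all add: flat.poset_rank_eq face.poset_rank_eq zero_set_zero)
  have weight: "(\<Sum>S | S \<subseteq> {1..?n}. of_nat (flag_f flat_poset S) * theta_coeff ?n S U) = flat.weight (Some E) U"
    for U by (rule flat.sum_flag_f_theta_coeff) simp
  have "vartheta (qsym_of_poset flat_poset) =
      (\<Sum>U | U \<subseteq> {1..?n}. (2 ^ (card U + 1) * flat.weight (Some E) U) *\<^sub>q M_set ?n U)"
    unfolding qsym_of_poset_def n Let_def vartheta_sum_M_set weight ..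
  also have "\<dots> = (\<Sum>U | U \<subseteq> {1..?n}. (2 * of_nat (flag_f face_poset U)) *\<^sub>q M_set ?n U)"
  proof (rule sum.cong[OF refl])
    fix U assume "U \<in> {U. U \<subseteq> {1..?n}}"
    then have U: "U \<subseteq> {1..?n}" by simp
    have "flag_f face_poset U = face.flags (Some (\<lambda>e. 0)) U"
      using U by (intro face.flag_f_eq_flags[where n = "rank E"]) (simp_all add: zero_set_zero)
    then have "of_nat (flag_f face_poset U) = 2 ^ card U * flat.weight (Some E) U"
      using flags_eq_weight[OF zero_covector, of U] U by (simp add: zero_set_zero)
    then show "(2 ^ (card U + 1) * flat.weight (Some E) U) *\<^sub>q M_set ?n U =
        (2 * of_nat (flag_f face_poset U)) *\<^sub>q M_set ?n U"
      by simp
  qed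
  also have "\<dots> = 2 *\<^sub>q qsym_of_poset face_poset"
    unfolding qsym_of_poset_def n Let_def
    by (simp add: pser.scale_sum_right)
  finally show ?thesis .
qed

end

section \<open>Faces of zonotopes\<close>

definition sign_of :: "real \<Rightarrow> int" where
  "sign_of t = (if t > 0 then 1 else if t < 0 then -1 else 0)"

text \<open>
  The face of the segment from \<open>a\<close> to \<open>b\<close> on which a linear functional is maximal, if \<open>s\<close> is the sign of the
  functional on \<open>b - a\<close>.
\<close>

definition segment_face :: "'a::euclidean_space \<Rightarrow> 'a \<Rightarrow> int \<Rightarrow> 'a set" where
  "segment_face a b s = (if s > 0 then {b} else if s < 0 then {a} else closed_segment a b)"

lemma segment_face_subset: "segment_face a b s \<subseteq> closed_segment a b"
  by (auto simp: segment_face_def)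

lemma segment_face_nonempty: "\<exists>w. w \<in> segment_face a b s"
  by (auto simp: segment_face_def)

lemma segment_face_mono: "t = 0 \<or> t = s \<Longrightarrow> segment_face a b s \<subseteq> segment_face a b t"
  by (auto simp: segment_face_def)

lemma segment_face_subsetD:
  assumes "segment_face a b s \<subseteq> segment_face a b t" "a \<noteq> b"
  shows "t = 0 \<or> sgn t = sgn s"
  using assms(1) assms(2) ends_in_segment[of a b]
  by (auto simp: segment_face_def sgn_if split: if_splits)

lemma inner_le_on_segment:
  assumes "w \<in> closed_segment a b"
  shows "y \<bullet> w \<le> max (y \<bullet> a) (y \<bullet> b)"
    and "y \<bullet> w = max (y \<bullet> a) (y \<bullet> b) \<longleftrightarrow> w \<in> segment_face a b (sign_of ((b - a) \<bullet> y))"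
proof -
  obtain u where u: "0 \<le> u" "u \<le> 1" "w = (1 - u) *\<^sub>R a + u *\<^sub>R b"
    using assms by (auto simp: in_segment)
  define D where "D = y \<bullet> b - y \<bullet> a"
  have yw: "y \<bullet> w = y \<bullet> a + u * D"
    unfolding u(3) D_def by (simp add: inner_add_right algebra_simps)
  have Dy: "(b - a) \<bullet> y = D" by (simp add: D_def inner_diff_right inner_commute)
  have b: "y \<bullet> b = y \<bullet> a + D" by (simp add: D_def)
  have m: "max (y \<bullet> a) (y \<bullet> b) = y \<bullet> a + max 0 D" unfolding b by auto
  have uD: "u * D \<le> max 0 D"
    using u(1,2) mult_right_mono[of u 1 D] mult_nonneg_nonpos[of u D] by (cases "D \<ge> 0") auto
  show "y \<bullet> w \<le> max (y \<bullet> a) (y \<bullet> b)" unfolding m yw using uD by simp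
  consider "D > 0" | "D < 0" | "D = 0" by linarith
  then show "y \<bullet> w = max (y \<bullet> a) (y \<bullet> b) \<longleftrightarrow> w \<in> segment_face a b (sign_of ((b - a) \<bullet> y))"
  proof cases
    case 1
    then have "y \<bullet> w = max (y \<bullet> a) (y \<bullet> b) \<longleftrightarrow> u = 1" unfolding m yw by auto
    moreover have "w = b \<longleftrightarrow> u = 1" using 1 yw b u(3) by auto
    ultimately show ?thesis using 1 by (simp add: Dy sign_of_def segment_face_def)
  next
    case 2
    then have "y \<bullet> w = max (y \<bullet> a) (y \<bullet> b) \<longleftrightarrow> u = 0" unfolding m yw by auto
    moreover have "w = a \<longleftrightarrow> u = 0" using 2 yw u(3) by auto
    ultimately show ?thesis using 2 by (simp add: Dy sign_of_def segment_face_def)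
  next
    case 3
    then show ?thesis unfolding m yw using assms by (simp add: Dy sign_of_def segment_face_def)
  qed
qed

locale zonotope =
  fixes E :: "'e set" and p q :: "'e \<Rightarrow> 'a::euclidean_space"
  assumes finite_E: "finite E"
begin

definition zono :: "'a set" where
  "zono = (\<Sum>e\<in>E. closed_segment (p e) (q e))"

definition part :: "('e \<Rightarrow> int) \<Rightarrow> 'a set" where
  "part \<sigma> = (\<Sum>e\<in>E. segment_face (p e) (q e) (\<sigma> e))"

definition signs :: "'a \<Rightarrow> 'e \<Rightarrow> int" where
  "signs y e = sign_of ((q e - p e) \<bullet> y)"

definition height :: "'a \<Rightarrow> real" where
  "height y = (\<Sum>e\<in>E. max (y \<bullet> p e) (y \<bullet> q e))"

lemma mem_zono_iff: "z \<in> zono \<longleftrightarrow> (\<exists>f. z = sum f E \<and> (\<forall>e\<in>E. f e \<in> closed_segment (p e) (q e)))"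
  unfolding zono_def set_sum_alt[OF finite_E] by auto

lemma mem_part_iff: "z \<in> part \<sigma> \<longleftrightarrow> (\<exists>f. z = sum f E \<and> (\<forall>e\<in>E. f e \<in> segment_face (p e) (q e) (\<sigma> e)))"
  unfolding part_def set_sum_alt[OF finite_E] by auto

lemma part_mono:
  assumes "\<And>e. e \<in> E \<Longrightarrow> \<tau> e = 0 \<or> \<tau> e = \<sigma> e"
  shows "part \<sigma> \<subseteq> part \<tau>"
proof
  fix z assume "z \<in> part \<sigma>"
  then obtain f where f: "z = sum f E" "\<forall>e\<in>E. f e \<in> segment_face (p e) (q e) (\<sigma> e)"
    by (auto simp: mem_part_iff)
  then have "\<forall>e\<in>E. f e \<in> segment_face (p e) (q e) (\<tau> e)"
    using segment_face_mono[OF assms] by blast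
  then show "z \<in> part \<tau>" using f(1) by (auto simp: mem_part_iff)
qed

lemma part_cong: "(\<And>e. e \<in> E \<Longrightarrow> \<sigma> e = \<tau> e) \<Longrightarrow> part \<sigma> = part \<tau>"
  using part_mono[of \<sigma> \<tau>] part_mono[of \<tau> \<sigma>] by auto

lemma part_nonempty: "part \<sigma> \<noteq> {}"
proof -
  have "\<forall>e. \<exists>w. w \<in> segment_face (p e) (q e) (\<sigma> e)" using segment_face_nonempty by blast
  then obtain f where "\<forall>e. f e \<in> segment_face (p e) (q e) (\<sigma> e)" by metis
  then have "sum f E \<in> part \<sigma>" by (auto simp: mem_part_iff)
  then show ?thesis by blast
qed

lemma inner_sum_le_height:
  assumes "\<forall>e\<in>E. f e \<in> closed_segment (p e) (q e)"
  shows "y \<bullet> sum f E \<le> height y"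
    and "y \<bullet> sum f E = height y \<longleftrightarrow> (\<forall>e\<in>E. f e \<in> segment_face (p e) (q e) (signs y e))"
proof -
  have le: "y \<bullet> f e \<le> max (y \<bullet> p e) (y \<bullet> q e)" if "e \<in> E" for e
    using inner_le_on_segment(1) assms that by blast
  then show "y \<bullet> sum f E \<le> height y"
    unfolding inner_sum_right height_def by (rule sum_mono)
  have "y \<bullet> sum f E = height y \<longleftrightarrow> (\<forall>e\<in>E. y \<bullet> f e = max (y \<bullet> p e) (y \<bullet> q e))"
    unfolding inner_sum_right height_def
    using sum_mono_inv[OF _ le _ finite_E] by (auto intro!: sum.cong)
  then show "y \<bullet> sum f E = height y \<longleftrightarrow> (\<forall>e\<in>E. f e \<in> segment_face (p e) (q e) (signs y e))"
    using inner_le_on_segment(2) assms unfolding signs_def by blast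
qed

lemma zono_below: "zono \<subseteq> {z. y \<bullet> z \<le> height y}"
  using inner_sum_le_height(1) by (auto simp: mem_zono_iff)

lemma part_signs: "part (signs y) = zono \<inter> {z. y \<bullet> z = height y}"
proof (intro equalityI subsetI)
  fix z assume "z \<in> part (signs y)"
  then obtain f where f: "z = sum f E" "\<forall>e\<in>E. f e \<in> segment_face (p e) (q e) (signs y e)"
    by (auto simp: mem_part_iff)
  then have "\<forall>e\<in>E. f e \<in> closed_segment (p e) (q e)" using segment_face_subset by blast
  then show "z \<in> zono \<inter> {z. y \<bullet> z = height y}"
    using inner_sum_le_height(2) f by (auto simp: mem_zono_iff)
next
  fix z assume "z \<in> zono \<inter> {z. y \<bullet> z = height y}"
  then obtain f where f: "z = sum f E" "\<forall>e\<in>E. f e \<in> closed_segment (p e) (q e)" "y \<bullet> z = height y"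
    by (auto simp: mem_zono_iff)
  then show "z \<in> part (signs y)"
    using inner_sum_le_height(2)[OF f(2)] by (auto simp: mem_part_iff)
qed

text \<open>
  A sum of points of the segments attains the maximum of a functional only if each summand does, so an
  inclusion between Minkowski sums of faces can be tested on each segment separately.
\<close>

lemma part_subset_part_signs:
  assumes "part \<sigma> \<subseteq> part (signs y)" "e \<in> E"
  shows "segment_face (p e) (q e) (\<sigma> e) \<subseteq> segment_face (p e) (q e) (signs y e)"
proof
  fix w assume w: "w \<in> segment_face (p e) (q e) (\<sigma> e)"
  obtain f where "sum f E \<in> part \<sigma>" "\<forall>e\<in>E. f e \<in> segment_face (p e) (q e) (\<sigma> e)"
    using part_nonempty[of \<sigma>] mem_part_iff[of _ \<sigma>] by blast
  then have f: "\<forall>i\<in>E. (f(e := w)) i \<in> segment_face (p i) (q i) (\<sigma> i)" using w by auto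
  then have "sum (f(e := w)) E \<in> part (signs y)" using assms(1) mem_part_iff by blast
  then have "y \<bullet> sum (f(e := w)) E = height y" unfolding part_signs by blast
  moreover have "\<forall>i\<in>E. (f(e := w)) i \<in> closed_segment (p i) (q i)"
    using f segment_face_subset by blast
  ultimately have "\<forall>i\<in>E. (f(e := w)) i \<in> segment_face (p i) (q i) (signs y i)"
    using inner_sum_le_height(2) by blast
  then show "w \<in> segment_face (p e) (q e) (signs y e)" using assms(2) by (metis fun_upd_same)
qed

lemma polytope_zono: "polytope zono"
proof -
  have "finite (\<Sum>e\<in>E. {p e, q e})"
    using finite_E by (induction E rule: finite_induct) (auto simp: finite_set_plus set_zero)
  moreover have "zono = convex hull (\<Sum>e\<in>E. {p e, q e})"
    by (simp add: zono_def convex_hull_set_sum segment_convex_hull)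
  ultimately show ?thesis unfolding polytope_def by blast
qed

text \<open>
  Faces of polytopes are exposed, that is, cut out by a linear functional.
\<close>

lemma face_of_zono_iff: "F face_of zono \<longleftrightarrow> F = {} \<or> F \<in> range (\<lambda>y. part (signs y))"
proof
  assume "F face_of zono"
  then have "F exposed_face_of zono"
    using exposed_face_of_polyhedron[OF polytope_imp_polyhedron[OF polytope_zono]] by blast
  then obtain y b where y: "zono \<subseteq> {z. y \<bullet> z \<le> b}" "F = zono \<inter> {z. y \<bullet> z = b}"
    unfolding exposed_face_of_def by blast
  have "b = height y" if ne: "F \<noteq> {}"
  proof (rule antisym)
    obtain z where "z \<in> zono" "y \<bullet> z = b" using ne y(2) by blast
    then show "b \<le> height y" using zono_below[of y] by blast
    obtain z' where "z' \<in> part (signs y)" using part_nonempty by blast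
    then have "z' \<in> zono" "y \<bullet> z' = height y" by (simp_all add: part_signs)
    then show "height y \<le> b" using y(1) by auto
  qed
  then show "F = {} \<or> F \<in> range (\<lambda>y. part (signs y))" using y(2) part_signs by blast
next
  have cv: "convex zono" using polytope_zono by (rule polytope_imp_convex)
  assume "F = {} \<or> F \<in> range (\<lambda>y. part (signs y))"
  then show "F face_of zono"
    unfolding part_signs
    using face_of_Int_supporting_hyperplane_le[OF cv] zono_below by fastforce
qed

end

lemma normal_vectors_collinear:
  fixes v w :: "'a::euclidean_space"
  assumes "normal_vector v H" "normal_vector w H"
  shows "\<exists>c. c \<noteq> 0 \<and> w = c *\<^sub>R v"
proof -
  have v: "v \<noteq> 0" "w \<noteq> 0" "\<And>x. v \<bullet> x = 0 \<longleftrightarrow> w \<bullet> x = 0"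
    using assms unfolding normal_vector_def by auto
  define c where "c = (w \<bullet> v) / (v \<bullet> v)"
  define x where "x = w - c *\<^sub>R v"
  have vx: "v \<bullet> x = 0" using v(1) by (simp add: x_def c_def inner_diff_right inner_commute)
  then have "w \<bullet> x = 0" using v(3) by blast
  then have "x \<bullet> x = 0" using vx by (simp add: x_def inner_diff_left)
  then have "w = c *\<^sub>R v" by (simp add: x_def)
  then show ?thesis using v(2) by (intro exI[of _ c]) auto
qed

lemma sign_of_scaled: "sign_of (c * t) = sign_of c * sign_of t"
  by (auto simp: sign_of_def mult_less_0_iff zero_less_mult_iff)

context covectors
begin

text \<open>
  The generator \<open>q e - p e\<close> of the zonotope is a nonzero multiple \<open>c e\<close> of the normal vector \<open>v e\<close>, possibly a
  negative one. Therefore the signs of \<open>X\<close> are corrected by the signs of \<open>c\<close> before \<open>X\<close> selects a face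
  of each segment. The maximum \<open>None\<close> of the face lattice is the empty face.
\<close>

lemma face_poset_isomorphic_zonotope:
  fixes H :: "'e \<Rightarrow> 'a::euclidean_space set"
  assumes v: "\<forall>e\<in>E. normal_vector (v e) (H e)" and L: "\<L> = arrangement_covectors E v"
    and pq: "\<forall>e\<in>E. normal_vector (q e - p e) (H e)"
  shows "poset_isomorphic face_poset (polytope_face_lattice (\<Sum>e\<in>E. closed_segment (p e) (q e)))"
proof -
  interpret zonotope E p q by unfold_locales (rule finite_ground)
  have "\<forall>e\<in>E. \<exists>c. c \<noteq> 0 \<and> q e - p e = c *\<^sub>R v e"
    using normal_vectors_collinear v pq by blast
  then obtain c where c: "\<And>e. e \<in> E \<Longrightarrow> c e \<noteq> 0" "\<And>e. e \<in> E \<Longrightarrow> q e - p e = c e *\<^sub>R v e"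
    by metis
  define \<phi> where "\<phi> X = part (\<lambda>e. sign_of (c e) * X e)" for X
  define f where "f P = (case P of None \<Rightarrow> {} | Some X \<Rightarrow> \<phi> X)" for P
  define cov where "cov y = (\<lambda>e. if e \<in> E then sign_of (v e \<bullet> y) else 0)" for y
  have L': "\<L> = range cov"
    unfolding L arrangement_covectors_def cov_def sign_of_def by (simp add: if_distrib)
  have \<phi>_cov: "\<phi> (cov y) = part (signs y)" for y
    unfolding \<phi>_def by (rule part_cong) (simp add: cov_def signs_def c(2) sign_of_scaled)
  have sc: "sign_of (c e) = 1 \<or> sign_of (c e) = -1" if "e \<in> E" for e
    using c(1)[OF that] by (auto simp: sign_of_def)
  have sub: "\<phi> X \<subseteq> \<phi> Y \<longleftrightarrow> conforms Y X" if X: "X \<in> \<L>" and Y: "Y \<in> \<L>" for X Y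
  proof
    assume "conforms Y X"
    then show "\<phi> X \<subseteq> \<phi> Y"
      unfolding \<phi>_def by (intro part_mono) (auto simp: conforms_def)
  next
    assume s: "\<phi> X \<subseteq> \<phi> Y"
    obtain y where y: "Y = cov y" using Y L' by blast
    have "Y e = 0 \<or> Y e = X e" for e
    proof (cases "e \<in> E")
      case True
      have "segment_face (p e) (q e) (sign_of (c e) * X e) \<subseteq> segment_face (p e) (q e) (signs y e)"
        by (rule part_subset_part_signs) (use s True \<phi>_cov y in \<open>simp_all add: \<phi>_def\<close>)
      moreover have "signs y e = sign_of (c e) * Y e"
        using True by (simp add: y cov_def signs_def c(2) sign_of_scaled)
      moreover have "p e \<noteq> q e" using pq True by (auto simp: normal_vector_def)
      ultimately have "sign_of (c e) * Y e = 0 \<or> sgn (sign_of (c e) * Y e) = sgn (sign_of (c e) * X e)"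
        using segment_face_subsetD by metis
      then show ?thesis
        using sc[OF True] covector_values[OF X, of e] covector_values[OF Y, of e] by auto
    next
      case False
      then show ?thesis using covector_outside[OF Y] by blast
    qed
    then show "conforms Y X" by (simp add: conforms_def)
  qed
  let ?P = "polytope_face_lattice (\<Sum>e\<in>E. closed_segment (p e) (q e))"
  have P: "(F, G) \<in> ?P \<longleftrightarrow> F face_of zono \<and> G face_of zono \<and> F \<subseteq> G" for F G
    by (simp add: polytope_face_lattice_def zono_def)
  have "Field ?P = {F. F face_of zono}"
    unfolding Field_def using P by blast
  also have "\<dots> = insert {} (\<phi> ` \<L>)"
    unfolding face_of_zono_iff L' image_image \<phi>_cov by blast
  also have "\<dots> = f ` Field face_poset"
    unfolding Field_face_poset by (simp add: f_def image_image)
  finally have img: "f ` Field face_poset = Field ?P" ..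
  have iff: "(a, b) \<in> face_poset \<longleftrightarrow> f a \<subseteq> f b" if "a \<in> Field face_poset" "b \<in> Field face_poset" for a b
    using that part_nonempty sub
    by (cases a; cases b) (auto simp: f_def Field_face_poset \<phi>_def[symmetric], auto simp: \<phi>_def)
  have "inj_on f (Field face_poset)"
  proof (rule inj_onI)
    fix a b assume ab: "a \<in> Field face_poset" "b \<in> Field face_poset" "f a = f b"
    have "(a, b) \<in> face_poset" "(b, a) \<in> face_poset"
      using iff[OF ab(1,2)] iff[OF ab(2,1)] ab(3) by simp_all
    then show "a = b" by (rule face.order_antisym)
  qed
  moreover have "(a, b) \<in> face_poset \<longleftrightarrow> (f a, f b) \<in> ?P"
    if "a \<in> Field face_poset" "b \<in> Field face_poset" for a b
  proof -
    have "f a face_of zono" "f b face_of zono"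
      using that img \<open>Field ?P = {F. F face_of zono}\<close> by blast+
    then show ?thesis using iff[OF that] P by blast
  qed
  ultimately show ?thesis
    unfolding poset_isomorphic_def bij_betw_def using img by blast
qed

end

section \<open>The image of the lattice of flats under \<open>vartheta\<close>\<close>

theorem proposition3p5:
  fixes E :: "'e set" and \<L> :: "'e sign_vector set"
  assumes "oriented_matroid E \<L>"
  shows "graded_poset (adjoin_bot (geometric_lattice E \<L>)) \<and>
    graded_poset (dual_face_lattice \<L>) \<and>
    vartheta (qsym_of_poset (adjoin_bot (geometric_lattice E \<L>))) =
      2 *\<^sub>q qsym_of_poset (dual_face_lattice \<L>) \<and>
    (\<forall>(H :: 'e \<Rightarrow> 'a::euclidean_space set) v p q.
      (\<forall>e\<in>E. normal_vector (v e) (H e)) \<longrightarrow>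
      \<L> = arrangement_covectors E v \<longrightarrow>
      (\<forall>e\<in>E. normal_vector (q e - p e) (H e)) \<longrightarrow>
      poset_isomorphic (dual_face_lattice \<L>)
        (polytope_face_lattice (\<Sum>e\<in>E. closed_segment (p e) (q e))))"
proof -
  interpret covectors E \<L> by unfold_locales (rule assms)
  show ?thesis
    using flat.graded face.graded vartheta_qsym_flats face_poset_isomorphic_zonotope by blast
qed

end
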